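(* Let $E_c$ and $E_d$ be central extensions of $G$ by $\mathbb{F}_p$ represented by the cohomology classes $[c]$ and $[d]$ in $\mathrm{H}^2(G;\mathbb{F}_p)$, respectively. Then $E_c$ and $E_d$ are isomorphic (as groups) if and only if $[c]\sim_A[d]$.
   Context: Let $p$ be a prime and let $G\neq 0$ be a finite abelian $p$-group, written additively; if $p=2$, assume that $G$ has no cyclic direct factor of order $2$. $\mathbb{F}_p$ is a trivial $G$-module. A class $[c]\in\mathrm{H}^2(G;\mathbb{F}_p)$ represents the central extension $E_c=G\times\mathbb{F}_p$ with product $(g_1,m_1)(g_2,m_2)=(g_1+g_2,m_1+m_2+c(g_1,g_2))$. The group $A=\operatorname{Aut}(G)\times\mathbb{Z}_p^*$ acts on $\mathrm{H}^2(G;\mathbb{F}_p)$ by $(\sigma,\lambda)\cdot[c]=[\lambda c\sigma^{-1}]$, i.e. the class of $(x,y)\mapsto\lambda\,c(\sigma^{-1}(x),\sigma^{-1}(y))$; $[c]\sim_A[d]$ means that $[c]$ and $[d]$ lie in the same $A$-orbit. *)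

theory Defs
  imports
    "HOL-Algebra.Elementary_Groups"
    "HOL-Algebra.Group_Action"
    "HOL-Number_Theory.Residues"
begin

text \<open>
  The group \<open>G\<close> is a group in the sense of HOL-Algebra, so its operation, additive in the
  mathematical text, is written \<open>\<otimes>\<close>.  The coefficients are the additive group of a ring \<open>R\<close> with
  trivial \<open>G\<close>-action; the statement takes \<open>R = residue_ring p\<close>, whose carrier is \<open>{0..p - 1}\<close>.
  Cochains are extensional functions, so that they are determined by their values on \<open>carrier G\<close>.
  Cocycles are not required to be normalised.
\<close>

definition cocycles2 :: "('a, 'm) monoid_scheme \<Rightarrow> ('r, 's) ring_scheme \<Rightarrow> ('a \<times> 'a \<Rightarrow> 'r) set" where
  "cocycles2 G R =
    {c \<in> carrier G \<times> carrier G \<rightarrow>\<^sub>E carrier R.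
      \<forall>x\<in>carrier G. \<forall>y\<in>carrier G. \<forall>z\<in>carrier G.
        c (y, z) \<oplus>\<^bsub>R\<^esub> c (x, y \<otimes>\<^bsub>G\<^esub> z) = c (x \<otimes>\<^bsub>G\<^esub> y, z) \<oplus>\<^bsub>R\<^esub> c (x, y)}"

definition coboundary1 ::
    "('a, 'm) monoid_scheme \<Rightarrow> ('r, 's) ring_scheme \<Rightarrow> ('a \<Rightarrow> 'r) \<Rightarrow> 'a \<times> 'a \<Rightarrow> 'r" where
  "coboundary1 G R f =
    (\<lambda>(x, y)\<in>carrier G \<times> carrier G. (f y \<ominus>\<^bsub>R\<^esub> f (x \<otimes>\<^bsub>G\<^esub> y)) \<oplus>\<^bsub>R\<^esub> f x)"

definition coboundaries2 ::
    "('a, 'm) monoid_scheme \<Rightarrow> ('r, 's) ring_scheme \<Rightarrow> ('a \<times> 'a \<Rightarrow> 'r) set" where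
  "coboundaries2 G R = coboundary1 G R ` (carrier G \<rightarrow>\<^sub>E carrier R)"

definition Z2 :: "('a, 'm) monoid_scheme \<Rightarrow> ('r, 's) ring_scheme \<Rightarrow> ('a \<times> 'a \<Rightarrow> 'r) monoid" where
  "Z2 G R =
    \<lparr>carrier = cocycles2 G R,
     monoid.mult = \<lambda>c d. \<lambda>u\<in>carrier G \<times> carrier G. c u \<oplus>\<^bsub>R\<^esub> d u,
     one = \<lambda>u\<in>carrier G \<times> carrier G. \<zero>\<^bsub>R\<^esub>\<rparr>"

definition H2 :: "('a, 'm) monoid_scheme \<Rightarrow> ('r, 's) ring_scheme \<Rightarrow> ('a \<times> 'a \<Rightarrow> 'r) set monoid" where
  "H2 G R = Z2 G R Mod coboundaries2 G R"

definition cohomology_class ::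
    "('a, 'm) monoid_scheme \<Rightarrow> ('r, 's) ring_scheme \<Rightarrow> ('a \<times> 'a \<Rightarrow> 'r) \<Rightarrow> ('a \<times> 'a \<Rightarrow> 'r) set" where
  "cohomology_class G R c = coboundaries2 G R #>\<^bsub>Z2 G R\<^esub> c"

text \<open>
  For a cocycle that is not normalised, the neutral element of the extension is \<open>(1, - c (1, 1))\<close>.
\<close>

definition central_extension ::
    "('a, 'm) monoid_scheme \<Rightarrow> ('r, 's) ring_scheme \<Rightarrow> ('a \<times> 'a \<Rightarrow> 'r) \<Rightarrow> ('a \<times> 'r) monoid" where
  "central_extension G R c =
    \<lparr>carrier = carrier G \<times> carrier R,
     monoid.mult = \<lambda>(g1, m1) (g2, m2). (g1 \<otimes>\<^bsub>G\<^esub> g2, m1 \<oplus>\<^bsub>R\<^esub> m2 \<oplus>\<^bsub>R\<^esub> c (g1, g2)),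
     one = (\<one>\<^bsub>G\<^esub>, \<ominus>\<^bsub>R\<^esub> c (\<one>\<^bsub>G\<^esub>, \<one>\<^bsub>G\<^esub>))\<rparr>"

definition acting_group ::
    "('a, 'm) monoid_scheme \<Rightarrow> ('r, 's) ring_scheme \<Rightarrow> (('a \<Rightarrow> 'a) \<times> 'r) monoid" where
  "acting_group G R = AutoGroup G \<times>\<times> units_of R"

definition twist ::
    "('a, 'm) monoid_scheme \<Rightarrow> ('r, 's) ring_scheme \<Rightarrow> ('a \<Rightarrow> 'a) \<times> 'r
      \<Rightarrow> ('a \<times> 'a \<Rightarrow> 'r) \<Rightarrow> 'a \<times> 'a \<Rightarrow> 'r" where
  "twist G R = (\<lambda>(\<sigma>, l) c. \<lambda>(x, y)\<in>carrier G \<times> carrier G.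
     l \<otimes>\<^bsub>R\<^esub> c ((inv\<^bsub>AutoGroup G\<^esub> \<sigma>) x, (inv\<^bsub>AutoGroup G\<^esub> \<sigma>) y))"

text \<open>
  A class is a coset, and it is acted upon elementwise; lemma \<open>H2_action_class\<close> below shows that
  this is the action \<open>[c] \<mapsto> [l c \<sigma>\<inverse>]\<close>.
\<close>

definition H2_action ::
    "('a, 'm) monoid_scheme \<Rightarrow> ('r, 's) ring_scheme \<Rightarrow> ('a \<Rightarrow> 'a) \<times> 'r
      \<Rightarrow> ('a \<times> 'a \<Rightarrow> 'r) set \<Rightarrow> ('a \<times> 'a \<Rightarrow> 'r) set" where
  "H2_action G R a = (\<lambda>C\<in>carrier (H2 G R). twist G R a ` C)"

definition same_orbit ::
    "('a, 'm) monoid_scheme \<Rightarrow> ('r, 's) ring_scheme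
      \<Rightarrow> ('a \<times> 'a \<Rightarrow> 'r) set \<Rightarrow> ('a \<times> 'a \<Rightarrow> 'r) set \<Rightarrow> bool" where
  "same_orbit G R C D \<longleftrightarrow>
    (\<exists>X\<in>orbits (acting_group G R) (carrier (H2 G R)) (H2_action G R). C \<in> X \<and> D \<in> X)"

definition finite_p_group :: "nat \<Rightarrow> ('a, 'm) monoid_scheme \<Rightarrow> bool" where
  "finite_p_group p G \<longleftrightarrow> group G \<and> finite (carrier G) \<and> (\<exists>n. order G = p ^ n)"

text \<open>For abelian \<open>G\<close>: a direct factor is a subgroup with a complement.\<close>

definition has_cyclic_direct_factor :: "('a, 'm) monoid_scheme \<Rightarrow> nat \<Rightarrow> bool" where
  "has_cyclic_direct_factor G n \<longleftrightarrow>
    (\<exists>H K. subgroup H G \<and> subgroup K G \<and> H \<inter> K = {\<one>\<^bsub>G\<^esub>} \<and> H <#>\<^bsub>G\<^esub> K = carrier G \<and>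
       cyclic_group (G\<lparr>carrier := H\<rparr>) \<and> card H = n)"

lemma comm_group_Z2:
  assumes "group G" and "cring R"
  shows "comm_group (Z2 G R)"
proof -
  interpret G: group G by fact
  interpret R: cring R by fact
  have val: "c (x, y) \<in> carrier R"
    if "c \<in> cocycles2 G R" "x \<in> carrier G" "y \<in> carrier G" for c x y
    using that by (auto simp: cocycles2_def)
  have eq: "c (y, z) \<oplus>\<^bsub>R\<^esub> c (x, y \<otimes>\<^bsub>G\<^esub> z) = c (x \<otimes>\<^bsub>G\<^esub> y, z) \<oplus>\<^bsub>R\<^esub> c (x, y)"
    if "c \<in> cocycles2 G R" "x \<in> carrier G" "y \<in> carrier G" "z \<in> carrier G" for c x y z
    using that by (auto simp: cocycles2_def)
  have extc: "c \<in> extensional (carrier G \<times> carrier G)" if "c \<in> cocycles2 G R" for c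
    using that by (auto simp: cocycles2_def PiE_def)
  show ?thesis
  proof (rule comm_groupI)
    fix c d assume "c \<in> carrier (Z2 G R)" "d \<in> carrier (Z2 G R)"
    then have cd: "c \<in> cocycles2 G R" "d \<in> cocycles2 G R" by (auto simp: Z2_def)
    have "(c (y, z) \<oplus>\<^bsub>R\<^esub> d (y, z)) \<oplus>\<^bsub>R\<^esub> (c (x, y \<otimes>\<^bsub>G\<^esub> z) \<oplus>\<^bsub>R\<^esub> d (x, y \<otimes>\<^bsub>G\<^esub> z))
        = (c (x \<otimes>\<^bsub>G\<^esub> y, z) \<oplus>\<^bsub>R\<^esub> d (x \<otimes>\<^bsub>G\<^esub> y, z)) \<oplus>\<^bsub>R\<^esub> (c (x, y) \<oplus>\<^bsub>R\<^esub> d (x, y))"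
      if xyz: "x \<in> carrier G" "y \<in> carrier G" "z \<in> carrier G" for x y z
    proof -
      have "(c (y, z) \<oplus>\<^bsub>R\<^esub> d (y, z)) \<oplus>\<^bsub>R\<^esub> (c (x, y \<otimes>\<^bsub>G\<^esub> z) \<oplus>\<^bsub>R\<^esub> d (x, y \<otimes>\<^bsub>G\<^esub> z))
          = (c (y, z) \<oplus>\<^bsub>R\<^esub> c (x, y \<otimes>\<^bsub>G\<^esub> z)) \<oplus>\<^bsub>R\<^esub> (d (y, z) \<oplus>\<^bsub>R\<^esub> d (x, y \<otimes>\<^bsub>G\<^esub> z))"
        using xyz cd by (simp add: val R.a_ac)
      also have "\<dots> = (c (x \<otimes>\<^bsub>G\<^esub> y, z) \<oplus>\<^bsub>R\<^esub> c (x, y)) \<oplus>\<^bsub>R\<^esub> (d (x \<otimes>\<^bsub>G\<^esub> y, z) \<oplus>\<^bsub>R\<^esub> d (x, y))"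
        using xyz cd by (simp add: eq)
      also have "\<dots> = (c (x \<otimes>\<^bsub>G\<^esub> y, z) \<oplus>\<^bsub>R\<^esub> d (x \<otimes>\<^bsub>G\<^esub> y, z)) \<oplus>\<^bsub>R\<^esub> (c (x, y) \<oplus>\<^bsub>R\<^esub> d (x, y))"
        using xyz cd by (simp add: val R.a_ac)
      finally show ?thesis .
    qed
    then show "c \<otimes>\<^bsub>Z2 G R\<^esub> d \<in> carrier (Z2 G R)"
      using cd by (auto simp: Z2_def cocycles2_def val[OF cd(1)] val[OF cd(2)])
    show "c \<otimes>\<^bsub>Z2 G R\<^esub> d = d \<otimes>\<^bsub>Z2 G R\<^esub> c"
      using cd by (auto simp: Z2_def val R.a_comm intro!: restrict_ext)
  next
    fix c d e assume "c \<in> carrier (Z2 G R)" "d \<in> carrier (Z2 G R)" "e \<in> carrier (Z2 G R)"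
    then show "c \<otimes>\<^bsub>Z2 G R\<^esub> d \<otimes>\<^bsub>Z2 G R\<^esub> e = c \<otimes>\<^bsub>Z2 G R\<^esub> (d \<otimes>\<^bsub>Z2 G R\<^esub> e)"
      by (auto simp: Z2_def val R.a_assoc intro!: restrict_ext)
  next
    show "\<one>\<^bsub>Z2 G R\<^esub> \<in> carrier (Z2 G R)"
      by (auto simp: Z2_def cocycles2_def)
  next
    fix c assume "c \<in> carrier (Z2 G R)"
    then have c: "c \<in> cocycles2 G R" by (auto simp: Z2_def)
    then show "\<one>\<^bsub>Z2 G R\<^esub> \<otimes>\<^bsub>Z2 G R\<^esub> c = c"
      by (intro extensionalityI[of _ "carrier G \<times> carrier G"]) (auto simp: Z2_def val extc)
    define e where "e = (\<lambda>u\<in>carrier G \<times> carrier G. \<ominus>\<^bsub>R\<^esub> c u)"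
    have "\<ominus>\<^bsub>R\<^esub> c (y, z) \<oplus>\<^bsub>R\<^esub> \<ominus>\<^bsub>R\<^esub> c (x, y \<otimes>\<^bsub>G\<^esub> z) = \<ominus>\<^bsub>R\<^esub> c (x \<otimes>\<^bsub>G\<^esub> y, z) \<oplus>\<^bsub>R\<^esub> \<ominus>\<^bsub>R\<^esub> c (x, y)"
      if "x \<in> carrier G" "y \<in> carrier G" "z \<in> carrier G" for x y z
      using that c by (simp add: val eq flip: R.minus_add)
    then have "e \<in> cocycles2 G R"
      by (auto simp: cocycles2_def e_def val[OF c])
    moreover have "e \<otimes>\<^bsub>Z2 G R\<^esub> c = \<one>\<^bsub>Z2 G R\<^esub>"
      using c by (auto simp: Z2_def e_def val R.l_neg intro!: restrict_ext)
    ultimately show "\<exists>e\<in>carrier (Z2 G R). e \<otimes>\<^bsub>Z2 G R\<^esub> c = \<one>\<^bsub>Z2 G R\<^esub>"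
      by (intro bexI[of _ e]) (auto simp: Z2_def)
  qed
qed

lemma normal_coboundaries2:
  assumes "group G" and "cring R"
  shows "coboundaries2 G R \<lhd> Z2 G R"
proof -
  interpret G: group G by fact
  interpret R: cring R by fact
  interpret Z: comm_group "Z2 G R" using assms by (rule comm_group_Z2)
  let ?F = "carrier G \<rightarrow>\<^sub>E carrier R"
  have val: "f x \<in> carrier R" if "f \<in> ?F" "x \<in> carrier G" for f x
    using that by auto
  have coc: "coboundary1 G R f \<in> cocycles2 G R" if f: "f \<in> ?F" for f
  proof -
    have "(f z \<ominus>\<^bsub>R\<^esub> f (y \<otimes>\<^bsub>G\<^esub> z) \<oplus>\<^bsub>R\<^esub> f y) \<oplus>\<^bsub>R\<^esub> (f (y \<otimes>\<^bsub>G\<^esub> z) \<ominus>\<^bsub>R\<^esub> f (x \<otimes>\<^bsub>G\<^esub> (y \<otimes>\<^bsub>G\<^esub> z)) \<oplus>\<^bsub>R\<^esub> f x)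
        = (f z \<ominus>\<^bsub>R\<^esub> f (x \<otimes>\<^bsub>G\<^esub> y \<otimes>\<^bsub>G\<^esub> z) \<oplus>\<^bsub>R\<^esub> f (x \<otimes>\<^bsub>G\<^esub> y)) \<oplus>\<^bsub>R\<^esub> (f y \<ominus>\<^bsub>R\<^esub> f (x \<otimes>\<^bsub>G\<^esub> y) \<oplus>\<^bsub>R\<^esub> f x)"
      if xyz: "x \<in> carrier G" "y \<in> carrier G" "z \<in> carrier G" for x y z
    proof -
      have "(a \<ominus>\<^bsub>R\<^esub> b \<oplus>\<^bsub>R\<^esub> c) \<oplus>\<^bsub>R\<^esub> (b \<ominus>\<^bsub>R\<^esub> k \<oplus>\<^bsub>R\<^esub> g) = (a \<ominus>\<^bsub>R\<^esub> k \<oplus>\<^bsub>R\<^esub> h) \<oplus>\<^bsub>R\<^esub> (c \<ominus>\<^bsub>R\<^esub> h \<oplus>\<^bsub>R\<^esub> g)"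
        if "a \<in> carrier R" "b \<in> carrier R" "c \<in> carrier R" "k \<in> carrier R" "g \<in> carrier R"
          "h \<in> carrier R" for a b c k g h
        using that by algebra
      then show ?thesis
        using xyz f by (simp add: val G.m_assoc)
    qed
    then show ?thesis
      using f by (auto simp: cocycles2_def coboundary1_def val[OF f])
  qed
  have "subgroup (coboundaries2 G R) (Z2 G R)"
  proof (rule Z.subgroupI)
    show "coboundaries2 G R \<subseteq> carrier (Z2 G R)"
      using coc by (auto simp: coboundaries2_def Z2_def)
    have "(\<lambda>x\<in>carrier G. \<zero>\<^bsub>R\<^esub>) \<in> ?F" by auto
    then show "coboundaries2 G R \<noteq> {}"
      unfolding coboundaries2_def by blast
  next
    fix c assume "c \<in> coboundaries2 G R"
    then obtain f where f: "f \<in> ?F" and c: "c = coboundary1 G R f"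
      by (auto simp: coboundaries2_def)
    define h where "h = (\<lambda>x\<in>carrier G. \<ominus>\<^bsub>R\<^esub> f x)"
    have h: "h \<in> ?F" using f by (auto simp: h_def)
    have "\<ominus>\<^bsub>R\<^esub> a \<ominus>\<^bsub>R\<^esub> (\<ominus>\<^bsub>R\<^esub> b) \<oplus>\<^bsub>R\<^esub> \<ominus>\<^bsub>R\<^esub> k \<oplus>\<^bsub>R\<^esub> (a \<ominus>\<^bsub>R\<^esub> b \<oplus>\<^bsub>R\<^esub> k) = \<zero>\<^bsub>R\<^esub>"
      if "a \<in> carrier R" "b \<in> carrier R" "k \<in> carrier R" for a b k
      using that by algebra
    then have "coboundary1 G R h \<otimes>\<^bsub>Z2 G R\<^esub> c = \<one>\<^bsub>Z2 G R\<^esub>"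
      using f by (auto simp: Z2_def c coboundary1_def h_def val intro!: restrict_ext)
    then have "inv\<^bsub>Z2 G R\<^esub> c = coboundary1 G R h"
      using coc[OF f] coc[OF h] by (intro Z.inv_equality) (auto simp: c Z2_def)
    with h show "inv\<^bsub>Z2 G R\<^esub> c \<in> coboundaries2 G R"
      by (auto simp: coboundaries2_def)
  next
    fix c d assume "c \<in> coboundaries2 G R" "d \<in> coboundaries2 G R"
    then obtain f g where f: "f \<in> ?F" "c = coboundary1 G R f" and g: "g \<in> ?F" "d = coboundary1 G R g"
      by (auto simp: coboundaries2_def)
    define h where "h = (\<lambda>x\<in>carrier G. f x \<oplus>\<^bsub>R\<^esub> g x)"
    have h: "h \<in> ?F" using f g by (auto simp: h_def)
    have "(a \<ominus>\<^bsub>R\<^esub> b \<oplus>\<^bsub>R\<^esub> k) \<oplus>\<^bsub>R\<^esub> (a' \<ominus>\<^bsub>R\<^esub> b' \<oplus>\<^bsub>R\<^esub> k') = (a \<oplus>\<^bsub>R\<^esub> a') \<ominus>\<^bsub>R\<^esub> (b \<oplus>\<^bsub>R\<^esub> b') \<oplus>\<^bsub>R\<^esub> (k \<oplus>\<^bsub>R\<^esub> k')"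
      if "a \<in> carrier R" "b \<in> carrier R" "k \<in> carrier R"
        "a' \<in> carrier R" "b' \<in> carrier R" "k' \<in> carrier R" for a b k a' b' k'
      using that by algebra
    then have "c \<otimes>\<^bsub>Z2 G R\<^esub> d = coboundary1 G R h"
      using f g by (auto simp: Z2_def coboundary1_def h_def val intro!: restrict_ext)
    with h show "c \<otimes>\<^bsub>Z2 G R\<^esub> d \<in> coboundaries2 G R"
      by (auto simp: coboundaries2_def)
  qed
  then show ?thesis
    by (rule Z.subgroup_imp_normal)
qed

lemma comm_group_H2:
  assumes "group G" and "cring R"
  shows "comm_group (H2 G R)"
  unfolding H2_def
  using comm_group_Z2[OF assms] normal_coboundaries2[OF assms]
  by (simp add: comm_group.abelian_FactGroup normal_imp_subgroup)

lemma group_central_extension: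
  assumes "group G" and "ring R" and c: "c \<in> cocycles2 G R"
  shows "group (central_extension G R c)"
proof -
  interpret G: group G by fact
  interpret R: ring R by fact
  have val: "c (x, y) \<in> carrier R" if "x \<in> carrier G" "y \<in> carrier G" for x y
    using that c by (auto simp: cocycles2_def)
  have eq: "c (y, z) \<oplus>\<^bsub>R\<^esub> c (x, y \<otimes>\<^bsub>G\<^esub> z) = c (x \<otimes>\<^bsub>G\<^esub> y, z) \<oplus>\<^bsub>R\<^esub> c (x, y)"
    if "x \<in> carrier G" "y \<in> carrier G" "z \<in> carrier G" for x y z
    using that c by (auto simp: cocycles2_def)
  have eq1: "c (\<one>\<^bsub>G\<^esub>, z) = c (\<one>\<^bsub>G\<^esub>, \<one>\<^bsub>G\<^esub>)" if "z \<in> carrier G" for z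
    using eq[of "\<one>\<^bsub>G\<^esub>" "\<one>\<^bsub>G\<^esub>" z] that by (simp add: val)
  show ?thesis
  proof (rule groupI)
    fix u v w
    assume "u \<in> carrier (central_extension G R c)" "v \<in> carrier (central_extension G R c)"
      "w \<in> carrier (central_extension G R c)"
    then obtain x y z k m n where uvw: "u = (x, k)" "v = (y, m)" "w = (z, n)"
      and xyz: "x \<in> carrier G" "y \<in> carrier G" "z \<in> carrier G"
      and kmn: "k \<in> carrier R" "m \<in> carrier R" "n \<in> carrier R"
      by (auto simp: central_extension_def)
    have "k \<oplus>\<^bsub>R\<^esub> m \<oplus>\<^bsub>R\<^esub> c (x, y) \<oplus>\<^bsub>R\<^esub> n \<oplus>\<^bsub>R\<^esub> c (x \<otimes>\<^bsub>G\<^esub> y, z)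
        = k \<oplus>\<^bsub>R\<^esub> m \<oplus>\<^bsub>R\<^esub> n \<oplus>\<^bsub>R\<^esub> (c (x \<otimes>\<^bsub>G\<^esub> y, z) \<oplus>\<^bsub>R\<^esub> c (x, y))"
      using xyz kmn by (simp add: val R.a_ac)
    also have "\<dots> = k \<oplus>\<^bsub>R\<^esub> m \<oplus>\<^bsub>R\<^esub> n \<oplus>\<^bsub>R\<^esub> (c (y, z) \<oplus>\<^bsub>R\<^esub> c (x, y \<otimes>\<^bsub>G\<^esub> z))"
      using xyz by (simp add: eq)
    also have "\<dots> = k \<oplus>\<^bsub>R\<^esub> (m \<oplus>\<^bsub>R\<^esub> n \<oplus>\<^bsub>R\<^esub> c (y, z)) \<oplus>\<^bsub>R\<^esub> c (x, y \<otimes>\<^bsub>G\<^esub> z)"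
      using xyz kmn by (simp add: val R.a_ac)
    finally show "u \<otimes>\<^bsub>central_extension G R c\<^esub> v \<otimes>\<^bsub>central_extension G R c\<^esub> w
        = u \<otimes>\<^bsub>central_extension G R c\<^esub> (v \<otimes>\<^bsub>central_extension G R c\<^esub> w)"
      using xyz by (simp add: uvw central_extension_def G.m_assoc)
  next
    fix u assume "u \<in> carrier (central_extension G R c)"
    then obtain x k where u: "u = (x, k)" "x \<in> carrier G" "k \<in> carrier R"
      by (auto simp: central_extension_def)
    have "\<ominus>\<^bsub>R\<^esub> c (\<one>\<^bsub>G\<^esub>, \<one>\<^bsub>G\<^esub>) \<oplus>\<^bsub>R\<^esub> k \<oplus>\<^bsub>R\<^esub> c (\<one>\<^bsub>G\<^esub>, \<one>\<^bsub>G\<^esub>) = k"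
      using u by (simp add: val R.a_ac R.r_neg R.r_neg2)
    then show "\<one>\<^bsub>central_extension G R c\<^esub> \<otimes>\<^bsub>central_extension G R c\<^esub> u = u"
      using u by (simp add: central_extension_def eq1[OF u(2)])
    let ?t = "k \<oplus>\<^bsub>R\<^esub> c (inv\<^bsub>G\<^esub> x, x) \<oplus>\<^bsub>R\<^esub> c (\<one>\<^bsub>G\<^esub>, \<one>\<^bsub>G\<^esub>)"
    have "\<ominus>\<^bsub>R\<^esub> ?t \<oplus>\<^bsub>R\<^esub> k \<oplus>\<^bsub>R\<^esub> c (inv\<^bsub>G\<^esub> x, x) = \<ominus>\<^bsub>R\<^esub> c (\<one>\<^bsub>G\<^esub>, \<one>\<^bsub>G\<^esub>)"
    proof -
      have "\<ominus>\<^bsub>R\<^esub> (s \<oplus>\<^bsub>R\<^esub> q) \<oplus>\<^bsub>R\<^esub> s = \<ominus>\<^bsub>R\<^esub> q" if "s \<in> carrier R" "q \<in> carrier R" for s q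
      proof -
        have "\<ominus>\<^bsub>R\<^esub> (s \<oplus>\<^bsub>R\<^esub> q) \<oplus>\<^bsub>R\<^esub> s = s \<oplus>\<^bsub>R\<^esub> (\<ominus>\<^bsub>R\<^esub> s \<oplus>\<^bsub>R\<^esub> \<ominus>\<^bsub>R\<^esub> q)"
          using that by (simp only: R.minus_add R.a_comm R.a_inv_closed R.a_closed)
        also have "\<dots> = \<ominus>\<^bsub>R\<^esub> q"
          using that by (intro R.r_neg2 R.a_inv_closed)
        finally show ?thesis .
      qed
      from this[of "k \<oplus>\<^bsub>R\<^esub> c (inv\<^bsub>G\<^esub> x, x)" "c (\<one>\<^bsub>G\<^esub>, \<one>\<^bsub>G\<^esub>)"] show ?thesis
        using u by (simp add: val R.a_assoc)
    qed
    then show "\<exists>v\<in>carrier (central_extension G R c).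
        v \<otimes>\<^bsub>central_extension G R c\<^esub> u = \<one>\<^bsub>central_extension G R c\<^esub>"
      using u by (intro bexI[of _ "(inv\<^bsub>G\<^esub> x, \<ominus>\<^bsub>R\<^esub> ?t)"]) (auto simp: central_extension_def val)
  qed (auto simp: central_extension_def val)
qed

lemma twist_in_cocycles2:
  assumes "group G" and "cring R" and c: "c \<in> cocycles2 G R"
    and a: "a \<in> carrier (acting_group G R)"
  shows "twist G R a c \<in> cocycles2 G R"
proof -
  interpret G: group G by fact
  interpret R: cring R by fact
  interpret A: group "AutoGroup G" by (rule G.AutoGroup)
  obtain \<sigma> l where a: "a = (\<sigma>, l)" "\<sigma> \<in> carrier (AutoGroup G)" "l \<in> carrier R"
    using a by (auto simp: acting_group_def units_of_def)
  define \<tau> where "\<tau> = inv\<^bsub>AutoGroup G\<^esub> \<sigma>"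
  have "\<tau> \<in> carrier (AutoGroup G)" using a by (simp add: \<tau>_def)
  then have \<tau>: "\<tau> \<in> hom G G" by (simp add: AutoGroup_def auto_def)
  have \<tau>c: "\<tau> x \<in> carrier G" if "x \<in> carrier G" for x
    using that \<tau> by (auto simp: hom_def)
  have val: "c (x, y) \<in> carrier R" if "x \<in> carrier G" "y \<in> carrier G" for x y
    using that c by (auto simp: cocycles2_def)
  have "l \<otimes>\<^bsub>R\<^esub> c (\<tau> y, \<tau> z) \<oplus>\<^bsub>R\<^esub> l \<otimes>\<^bsub>R\<^esub> c (\<tau> x, \<tau> (y \<otimes>\<^bsub>G\<^esub> z))
      = l \<otimes>\<^bsub>R\<^esub> c (\<tau> (x \<otimes>\<^bsub>G\<^esub> y), \<tau> z) \<oplus>\<^bsub>R\<^esub> l \<otimes>\<^bsub>R\<^esub> c (\<tau> x, \<tau> y)"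
    if "x \<in> carrier G" "y \<in> carrier G" "z \<in> carrier G" for x y z
    using that c a \<tau>c by (simp add: hom_mult[OF \<tau>] val cocycles2_def flip: R.r_distr)
  then show ?thesis
    using a by (auto simp: twist_def cocycles2_def \<tau>c val simp flip: \<tau>_def)
qed

lemma twist_coboundary1:
  assumes "group G" and "cring R" and f: "f \<in> carrier G \<rightarrow>\<^sub>E carrier R"
    and a: "a \<in> carrier (acting_group G R)"
  shows "twist G R a (coboundary1 G R f)
    = coboundary1 G R (\<lambda>x\<in>carrier G. snd a \<otimes>\<^bsub>R\<^esub> f ((inv\<^bsub>AutoGroup G\<^esub> (fst a)) x))"
proof -
  interpret G: group G by fact
  interpret R: cring R by fact
  interpret A: group "AutoGroup G" by (rule G.AutoGroup)
  obtain \<sigma> l where a: "a = (\<sigma>, l)" "\<sigma> \<in> carrier (AutoGroup G)" "l \<in> carrier R"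
    using a by (auto simp: acting_group_def units_of_def)
  define \<tau> where "\<tau> = inv\<^bsub>AutoGroup G\<^esub> \<sigma>"
  have "\<tau> \<in> carrier (AutoGroup G)" using a by (simp add: \<tau>_def)
  then have \<tau>: "\<tau> \<in> hom G G" by (simp add: AutoGroup_def auto_def)
  have \<tau>c: "\<tau> x \<in> carrier G" if "x \<in> carrier G" for x
    using that \<tau> by (auto simp: hom_def)
  have val: "f x \<in> carrier R" if "x \<in> carrier G" for x
    using that f by auto
  have "l \<otimes>\<^bsub>R\<^esub> (p \<ominus>\<^bsub>R\<^esub> q \<oplus>\<^bsub>R\<^esub> r) = l \<otimes>\<^bsub>R\<^esub> p \<ominus>\<^bsub>R\<^esub> l \<otimes>\<^bsub>R\<^esub> q \<oplus>\<^bsub>R\<^esub> l \<otimes>\<^bsub>R\<^esub> r"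
    if "p \<in> carrier R" "q \<in> carrier R" "r \<in> carrier R" for p q r
    using that a(3) by algebra
  then show ?thesis
    using a by (auto simp: twist_def coboundary1_def \<tau>c val hom_mult[OF \<tau>]
        simp flip: \<tau>_def intro!: restrict_ext)
qed

lemma twist_mult_Z2:
  assumes "group G" and "cring R" and c: "c \<in> cocycles2 G R" and d: "d \<in> cocycles2 G R"
    and a: "a \<in> carrier (acting_group G R)"
  shows "twist G R a (c \<otimes>\<^bsub>Z2 G R\<^esub> d) = twist G R a c \<otimes>\<^bsub>Z2 G R\<^esub> twist G R a d"
proof -
  interpret G: group G by fact
  interpret R: cring R by fact
  interpret A: group "AutoGroup G" by (rule G.AutoGroup)
  obtain \<sigma> l where a: "a = (\<sigma>, l)" "\<sigma> \<in> carrier (AutoGroup G)" "l \<in> carrier R"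
    using a by (auto simp: acting_group_def units_of_def)
  define \<tau> where "\<tau> = inv\<^bsub>AutoGroup G\<^esub> \<sigma>"
  have "\<tau> \<in> carrier (AutoGroup G)" using a by (simp add: \<tau>_def)
  then have \<tau>c: "\<tau> x \<in> carrier G" if "x \<in> carrier G" for x
    using that by (auto simp: AutoGroup_def auto_def hom_def)
  have val: "c (x, y) \<in> carrier R" "d (x, y) \<in> carrier R"
    if "x \<in> carrier G" "y \<in> carrier G" for x y
    using that c d by (auto simp: cocycles2_def)
  show ?thesis
    using a by (auto simp: twist_def Z2_def \<tau>c val R.r_distr simp flip: \<tau>_def
        intro!: restrict_ext)
qed

lemma twist_comp:
  assumes "group G" and "cring R" and c: "c \<in> cocycles2 G R"
    and a: "a \<in> carrier (acting_group G R)" and b: "b \<in> carrier (acting_group G R)"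
  shows "twist G R (a \<otimes>\<^bsub>acting_group G R\<^esub> b) c = twist G R a (twist G R b c)"
proof -
  interpret G: group G by fact
  interpret R: cring R by fact
  interpret A: group "AutoGroup G" by (rule G.AutoGroup)
  obtain \<sigma> l where a: "a = (\<sigma>, l)" "\<sigma> \<in> carrier (AutoGroup G)" "l \<in> carrier R"
    using a by (auto simp: acting_group_def units_of_def)
  obtain \<sigma>' l' where b: "b = (\<sigma>', l')" "\<sigma>' \<in> carrier (AutoGroup G)" "l' \<in> carrier R"
    using b by (auto simp: acting_group_def units_of_def)
  define \<tau> where "\<tau> = inv\<^bsub>AutoGroup G\<^esub> \<sigma>"
  define \<tau>' where "\<tau>' = inv\<^bsub>AutoGroup G\<^esub> \<sigma>'"
  have mem: "\<tau> \<in> carrier (AutoGroup G)" "\<tau>' \<in> carrier (AutoGroup G)"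
    using a b by (simp_all add: \<tau>_def \<tau>'_def)
  then have \<tau>c: "\<tau> x \<in> carrier G" "\<tau>' x \<in> carrier G" if "x \<in> carrier G" for x
    using that by (auto simp: AutoGroup_def auto_def hom_def)
  have inv: "inv\<^bsub>AutoGroup G\<^esub> (\<sigma> \<otimes>\<^bsub>AutoGroup G\<^esub> \<sigma>') = \<tau>' \<otimes>\<^bsub>AutoGroup G\<^esub> \<tau>"
    using a b by (simp add: A.inv_mult_group \<tau>_def \<tau>'_def)
  have comp: "(\<tau>' \<otimes>\<^bsub>AutoGroup G\<^esub> \<tau>) x = \<tau>' (\<tau> x)" if "x \<in> carrier G" for x
    using that mem by (simp add: AutoGroup_def BijGroup_def auto_def compose_def)
  have val: "c (x, y) \<in> carrier R" if "x \<in> carrier G" "y \<in> carrier G" for x y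
    using that c by (auto simp: cocycles2_def)
  show ?thesis
    using a b by (auto simp: twist_def acting_group_def units_of_def inv comp \<tau>c val R.m_assoc
        simp flip: \<tau>_def \<tau>'_def intro!: restrict_ext)
qed

lemma twist_one:
  assumes "group G" and "cring R" and c: "c \<in> cocycles2 G R"
  shows "twist G R \<one>\<^bsub>acting_group G R\<^esub> c = c"
proof -
  interpret G: group G by fact
  interpret R: cring R by fact
  interpret A: group "AutoGroup G" by (rule G.AutoGroup)
  have one: "\<one>\<^bsub>AutoGroup G\<^esub> x = x" if "x \<in> carrier G" for x
    using that by (simp add: AutoGroup_def BijGroup_def)
  have "c \<in> extensional (carrier G \<times> carrier G)"
    using c by (auto simp: cocycles2_def PiE_def)
  moreover have "c (x, y) \<in> carrier R" if "x \<in> carrier G" "y \<in> carrier G" for x y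
    using that c by (auto simp: cocycles2_def)
  ultimately show ?thesis
    by (intro extensionalityI[of _ "carrier G \<times> carrier G"])
      (auto simp: twist_def acting_group_def units_of_def one)
qed

lemma group_acting_group:
  assumes "group G" and "cring R"
  shows "group (acting_group G R)"
proof -
  interpret G: group G by fact
  interpret R: cring R by fact
  show ?thesis
    unfolding acting_group_def by (intro DirProd_group G.AutoGroup R.units_group)
qed

lemma H2_action_class:
  assumes "group G" and "cring R" and c: "c \<in> cocycles2 G R"
    and a: "a \<in> carrier (acting_group G R)"
  shows "H2_action G R a (cohomology_class G R c) = cohomology_class G R (twist G R a c)"
proof -
  interpret A: group "acting_group G R" using assms(1,2) by (rule group_acting_group)
  have B: "b \<in> cocycles2 G R" if "b \<in> coboundaries2 G R" for b
    using that normal_imp_subgroup[OF normal_coboundaries2[OF assms(1,2)]]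
    by (auto simp: Z2_def dest: subgroup.mem_carrier)
  have tB: "twist G R a b \<in> coboundaries2 G R"
    if b: "b \<in> coboundaries2 G R" and a: "a \<in> carrier (acting_group G R)" for a b
  proof -
    obtain f where f: "f \<in> carrier G \<rightarrow>\<^sub>E carrier R" "b = coboundary1 G R f"
      using b by (auto simp: coboundaries2_def)
    interpret G: group G by fact
    interpret R: cring R by fact
    have "inv\<^bsub>AutoGroup G\<^esub> (fst a) \<in> carrier (AutoGroup G)" "snd a \<in> carrier R"
      using a group.inv_closed[OF G.AutoGroup]
      by (auto simp: acting_group_def units_of_def)
    then have "(\<lambda>x\<in>carrier G. snd a \<otimes>\<^bsub>R\<^esub> f ((inv\<^bsub>AutoGroup G\<^esub> (fst a)) x)) \<in> carrier G \<rightarrow>\<^sub>E carrier R"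
      using f by (auto simp: AutoGroup_def auto_def hom_def intro!: R.m_closed)
    then show ?thesis
      using twist_coboundary1[OF assms(1,2) f(1) a] f(2) by (auto simp: coboundaries2_def)
  qed
  have "twist G R a ` coboundaries2 G R = coboundaries2 G R"
  proof
    show "coboundaries2 G R \<subseteq> twist G R a ` coboundaries2 G R"
    proof
      fix b assume b: "b \<in> coboundaries2 G R"
      let ?i = "inv\<^bsub>acting_group G R\<^esub> a"
      have "b = twist G R a (twist G R ?i b)"
        using twist_comp[OF assms(1,2) B[OF b] a A.inv_closed[OF a]]
          twist_one[OF assms(1,2) B[OF b]] a by simp
      then show "b \<in> twist G R a ` coboundaries2 G R"
        using tB[OF b A.inv_closed[OF a]] by blast
    qed
  qed (use tB[OF _ a] in blast)
  moreover have "twist G R a ` cohomology_class G R c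
      = (\<lambda>b. b \<otimes>\<^bsub>Z2 G R\<^esub> twist G R a c) ` twist G R a ` coboundaries2 G R"
    using twist_mult_Z2[OF assms(1,2) B c a]
    by (force simp: cohomology_class_def r_coset_def image_image)
  moreover have "cohomology_class G R c \<in> carrier (H2 G R)"
    using c by (auto simp: H2_def FactGroup_def RCOSETS_def cohomology_class_def Z2_def)
  ultimately show ?thesis
    by (auto simp: H2_action_def cohomology_class_def r_coset_def)
qed

lemma group_action_H2:
  assumes "group G" and "cring R"
  shows "group_action (acting_group G R) (carrier (H2 G R)) (H2_action G R)"
proof -
  let ?A = "acting_group G R" and ?E = "carrier (H2 G R)"
  interpret A: group ?A using assms by (rule group_acting_group)
  have cls: "\<exists>c\<in>cocycles2 G R. C = cohomology_class G R c" if "C \<in> ?E" for C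
    using that by (auto simp: H2_def FactGroup_def RCOSETS_def cohomology_class_def Z2_def)
  have mem: "cohomology_class G R c \<in> ?E" if "c \<in> cocycles2 G R" for c
    using that by (auto simp: H2_def FactGroup_def RCOSETS_def cohomology_class_def Z2_def)
  have closed: "H2_action G R a C \<in> ?E" if a: "a \<in> carrier ?A" and C: "C \<in> ?E" for a C
  proof -
    obtain c where "c \<in> cocycles2 G R" "C = cohomology_class G R c" using cls[OF C] by blast
    then show ?thesis
      using a by (simp add: H2_action_class[OF assms] mem twist_in_cocycles2[OF assms])
  qed
  have comp: "H2_action G R (a \<otimes>\<^bsub>?A\<^esub> b) C = H2_action G R a (H2_action G R b C)"
    if "a \<in> carrier ?A" "b \<in> carrier ?A" "C \<in> ?E" for a b C
    using cls[OF that(3)] that(1,2)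
    by (auto simp: H2_action_class[OF assms] twist_in_cocycles2[OF assms] twist_comp[OF assms])
  have one: "H2_action G R \<one>\<^bsub>?A\<^esub> C = C" if "C \<in> ?E" for C
    using cls[OF that] by (auto simp: H2_action_class[OF assms] twist_one[OF assms])
  have bij: "H2_action G R a \<in> Bij ?E" if a: "a \<in> carrier ?A" for a
  proof -
    have "H2_action G R (inv\<^bsub>?A\<^esub> a) (H2_action G R a C) = C"
      "H2_action G R a (H2_action G R (inv\<^bsub>?A\<^esub> a) C) = C" if "C \<in> ?E" for C
      using a that one by (simp_all flip: comp)
    then have "bij_betw (H2_action G R a) ?E ?E"
      using closed[OF a] closed[OF A.inv_closed[OF a]]
      by (intro bij_betw_byWitness[where f' = "H2_action G R (inv\<^bsub>?A\<^esub> a)"]) auto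
    then show ?thesis
      by (simp add: Bij_def H2_action_def)
  qed
  have "H2_action G R \<in> hom ?A (BijGroup ?E)"
  proof (rule homI)
    fix a b assume ab: "a \<in> carrier ?A" "b \<in> carrier ?A"
    then show "H2_action G R (a \<otimes>\<^bsub>?A\<^esub> b) = H2_action G R a \<otimes>\<^bsub>BijGroup ?E\<^esub> H2_action G R b"
      using bij comp
      by (intro extensionalityI[of _ ?E]) (auto simp: BijGroup_def compose_def H2_action_def)
  qed (simp add: BijGroup_def bij)
  then show ?thesis
    by (intro group_action.intro group_hom.intro group_hom_axioms.intro group_BijGroup A.group_axioms)
qed

end

theory Submission
  imports Defs
begin

text \<open>
  An isomorphism of extensions that carries the kernel \<open>M\<^sub>c\<close> of \<open>E\<^sub>c \<rightarrow> G\<close> onto the kernel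
  \<open>M\<^sub>d\<close> of \<open>E\<^sub>d \<rightarrow> G\<close> induces an automorphism of \<open>G\<close> and a unit of \<open>F\<^sub>p\<close>, and these identify the
  classes.  So suppose that \<open>\<phi> : E\<^sub>c \<rightarrow> E\<^sub>d\<close> carries \<open>M\<^sub>c\<close> to \<open>N \<noteq> M\<^sub>d\<close>.  Both quotients of \<open>E = E\<^sub>d\<close>
  are the abelian group \<open>G\<close>, so the commutators of \<open>E\<close> lie in \<open>M\<^sub>d \<inter> N = 1\<close> and \<open>E\<close> is a finite
  abelian \<open>p\<close>-group.  As \<open>E/M\<^sub>d\<close> and \<open>E/N\<close> are isomorphic, comparing the orders of their subgroups
  of \<open>p\<^sup>k\<close>-th powers shows that generators of \<open>M\<^sub>d\<close> and \<open>N\<close> have equal height, and elements of order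
  \<open>p\<close> and equal height are conjugate under automorphisms of \<open>E\<close>.  Correcting \<open>\<phi>\<close> by such an
  automorphism yields an isomorphism that preserves the kernels.
\<close>

section \<open>Elements of order \<open>p\<close> in a finite abelian \<open>p\<close>-group\<close>

text \<open>By Bezout, \<open>b\<close> is a product of powers of \<open>b [^] k\<close> and
  \<open>b [^] u\<close>.\<close>

lemma (in group) int_pow_coprime_mem:
  fixes k u :: int
  assumes K: "subgroup K G" and b: "b \<in> carrier G" and k: "b [^] k \<in> K" and u: "b [^] u \<in> K"
    and "coprime k u"
  shows "b \<in> K"
proof -
  obtain r s where rs: "r * k + s * u = 1"
    using bezout_int[of k u] \<open>coprime k u\<close> by auto
  have "b = b [^] (k * r + u * s)"
    using rs b by (simp add: mult.commute)
  also have "\<dots> = (b [^] k) [^] r \<otimes> (b [^] u) [^] s"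
    using b by (simp only: int_pow_mult int_pow_pow int_pow_closed)
  also have "\<dots> \<in> K"
    by (intro subgroup.m_closed[OF K] subgroup_int_pow_closed[OF K] k u)
  finally show ?thesis .
qed

text \<open>The exponents that send \<open>y\<close> into \<open>K\<close> form an ideal of the
  integers, so the gcd of \<open>p^(h+1)\<close> and \<open>t\<close> is one of them. It is a power
  of \<open>p\<close>, and a smaller one than \<open>p^(h+1)\<close> would put \<open>p^h\<close>
  into the ideal. Thus \<open>y\<close> has order exactly \<open>p^(h+1)\<close> modulo
  \<open>K\<close>.\<close>

lemma (in group) int_pow_minimal_exponent:
  assumes "prime p" and K: "subgroup K G" and y: "y \<in> carrier G"
    and Suc: "y [^] (int p ^ Suc h) \<in> K" and h: "y [^] (int p ^ h) \<notin> K"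
    and t: "y [^] (t::int) \<in> K"
  shows "int p ^ Suc h dvd t"
proof -
  let ?g = "gcd (int p ^ Suc h) t"
  obtain r s where rs: "r * int p ^ Suc h + s * t = ?g"
    using bezout_int by blast
  have "y [^] ?g = (y [^] (int p ^ Suc h)) [^] r \<otimes> (y [^] t) [^] s"
    using y by (simp only: int_pow_mult int_pow_pow rs[symmetric] mult.commute int_pow_closed)
  also have "\<dots> \<in> K"
    by (intro subgroup.m_closed[OF K] subgroup_int_pow_closed[OF K] Suc t)
  finally have g: "y [^] ?g \<in> K" .
  have "prime (int p)" using \<open>prime p\<close> by simp
  then obtain i where i: "i \<le> Suc h" "?g = int p ^ i"
    using divides_primepow_weak[of "int p" ?g "Suc h"] by (auto simp: abs_mult normalize_int_def)
  have "i = Suc h"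
  proof (rule ccontr)
    assume "i \<noteq> Suc h"
    then have "int p ^ h = ?g * int p ^ (h - i)"
      using i by (simp flip: power_add)
    then have "y [^] (int p ^ h) = (y [^] ?g) [^] (int p ^ (h - i))"
      using y by (simp only: int_pow_pow)
    then show False
      using h subgroup_int_pow_closed[OF K g] by simp
  qed
  then show ?thesis
    using i(2) by (metis gcd_dvd2)
qed

text \<open>
  Any subgroup maximal among those that contain \<open>P\<close> and avoid \<open>y\<^bsup>p^h\<^esup>\<close> will do.
\<close>

lemma (in comm_group) avoiding_subgroup_with_cyclic_quotient:
  assumes "prime p" and fin: "finite (carrier G)"
    and ord: "\<And>a. a \<in> carrier G \<Longrightarrow> a [^] (int p ^ n) = \<one>"
    and P: "subgroup P G" and pow: "\<And>a. a \<in> carrier G \<Longrightarrow> a [^] (int p ^ Suc h) \<in> P"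
    and y: "y \<in> carrier G" and x: "y [^] (int p ^ h) \<notin> P"
  shows "\<exists>K. subgroup K G \<and> P \<subseteq> K \<and> y [^] (int p ^ h) \<notin> K \<and>
    (\<forall>e\<in>carrier G. \<exists>k\<in>K. \<exists>t::int. e = k \<otimes> y [^] t)"
proof -
  define x where "x = y [^] (int p ^ h)"
  define F where "F = {K. subgroup K G \<and> P \<subseteq> K \<and> x \<notin> K}"
  have "F \<subseteq> Pow (carrier G)" by (auto simp: F_def dest: subgroup.mem_carrier)
  then have "finite F" using fin by (simp add: finite_subset)
  moreover have "P \<in> F" using P assms by (auto simp: F_def x_def)
  ultimately obtain K where "K \<in> F" and max: "\<And>L. L \<in> F \<Longrightarrow> K \<subseteq> L \<Longrightarrow> L = K"
    using finite_has_maximal[of F] by blast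
  then have K: "subgroup K G" "P \<subseteq> K" "x \<notin> K" by (auto simp: F_def)
  interpret K: subgroup K G by fact
  note Kpow = subgroup_int_pow_closed[OF K(1)]
  have adj: "subgroup (K <#> generate G {b}) G" "K \<subseteq> K <#> generate G {b}" "b \<in> K <#> generate G {b}"
    and adj_iff: "e \<in> K <#> generate G {b} \<longleftrightarrow> (\<exists>k\<in>K. \<exists>t::int. e = k \<otimes> b [^] t)"
    if b: "b \<in> carrier G" for b e
  proof -
    show iff: "e \<in> K <#> generate G {b} \<longleftrightarrow> (\<exists>k\<in>K. \<exists>t::int. e = k \<otimes> b [^] t)" for e
      using b by (auto simp: generate_pow set_mult_def)
    show "subgroup (K <#> generate G {b}) G"
      using b by (intro mult_subgroups K generate_is_subgroup) auto
    show "K \<subseteq> K <#> generate G {b}"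
    proof
      fix k assume "k \<in> K"
      then show "k \<in> K <#> generate G {b}"
        unfolding iff using b by (intro bexI[of _ k] exI[of _ 0]) auto
    qed
    show "b \<in> K <#> generate G {b}"
      unfolding iff using b by (intro bexI[of _ \<one>] exI[of _ 1]) auto
  qed
  define S where "S = K <#> generate G {y}"
  note S = adj[OF y, folded S_def] and S_iff = adj_iff[OF y, folded S_def]
  note Spow = subgroup_int_pow_closed[OF S(1)]
  have xc: "x \<in> carrier G" and xS: "x \<in> S" using y S by (auto simp: x_def Spow)
  \<comment> \<open>The subgroup \<open>S\<close> generated by \<open>K\<close> and \<open>y\<close>
    is everything: an element outside it contradicts the choice of \<open>K\<close>.\<close>
  have "a \<in> S" if a: "a \<in> carrier G" for a
  proof (rule ccontr)
    assume "a \<notin> S"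
    have "\<exists>j. a [^] (int p ^ j) \<in> S"
      using ord[OF a] subgroup.one_closed[OF S(1)] by metis
    then obtain j where j: "a [^] (int p ^ j) \<in> S" "\<And>i. i < j \<Longrightarrow> a [^] (int p ^ i) \<notin> S"
      using exists_least_iff[of "\<lambda>j. a [^] (int p ^ j) \<in> S"] by blast
    have "j \<noteq> 0" using j(1) a \<open>a \<notin> S\<close> by (intro notI) simp
    \<comment> \<open>The last iterated \<open>p\<close>-th power of \<open>a\<close> outside
      \<open>S\<close>, so that \<open>b [^] int p\<close> lies in \<open>S\<close>.\<close>
    define b where "b = a [^] (int p ^ (j - 1))"
    have b: "b \<in> carrier G" "b \<notin> S" using a j(2)[of "j - 1"] \<open>j \<noteq> 0\<close> by (auto simp: b_def)
    have "b [^] int p = a [^] (int p ^ j)"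
      using a \<open>j \<noteq> 0\<close> by (cases j) (simp_all add: b_def int_pow_pow mult.commute)
    then have "b [^] int p \<in> S" using j(1) by simp
    then obtain k and t :: int where k: "k \<in> K" and bp: "b [^] int p = k \<otimes> y [^] t"
      unfolding S_iff by blast
    \<comment> \<open>Raising to the power \<open>p^h\<close> turns \<open>y [^] t\<close> into
      \<open>x [^] t\<close>, while all \<open>p^(h+1)\<close>-th powers lie in \<open>K\<close>.
      Hence \<open>x [^] t \<in> K\<close>, and since \<open>x [^] int p \<in> K\<close> but
      \<open>x \<notin> K\<close>, \<open>p\<close> divides \<open>t\<close>.\<close>
    have "b [^] (int p ^ Suc h) = (b [^] int p) [^] (int p ^ h)"
      using b by (simp add: int_pow_pow)
    also have "\<dots> = k [^] (int p ^ h) \<otimes> x [^] t"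
      using k y by (simp add: bp int_pow_distrib int_pow_pow x_def mult.commute)
    finally have "x [^] t = inv (k [^] (int p ^ h)) \<otimes> b [^] (int p ^ Suc h)"
      using k xc b by (simp add: inv_solve_left)
    also have "\<dots> \<in> K"
      using pow[OF b(1)] K(2) k by (auto intro!: Kpow)
    finally have xt: "x [^] t \<in> K" .
    have "x [^] int p = y [^] (int p ^ Suc h)"
      using y by (simp add: x_def int_pow_pow mult.commute)
    then have xp: "x [^] int p \<in> K" using pow[OF y] K(2) by auto
    have "int p dvd t"
    proof (rule ccontr)
      assume "\<not> int p dvd t"
      then have "coprime (int p) t" using \<open>prime p\<close> by (simp add: prime_imp_coprime)
      then show False using int_pow_coprime_mem[OF K(1) xc xp xt] K(3) by simp
    qed
    then obtain s where s: "t = int p * s" by blast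
    \<comment> \<open>Dividing \<open>b\<close> by \<open>y [^] s\<close>, where
      \<open>t = p s\<close>, removes the \<open>y\<close>-part of its \<open>p\<close>-th power:
      \<open>b'\<close> is still outside \<open>S\<close>, but now \<open>b' [^] int p\<close> lies
      in \<open>K\<close>.\<close>
    define b' where "b' = b \<otimes> y [^] (- s)"
    have b': "b' \<in> carrier G" using b y by (simp add: b'_def)
    have b'S: "b' \<notin> S"
    proof
      assume "b' \<in> S"
      then have "b' \<otimes> y [^] s \<in> S" using S(3) Spow subgroup.m_closed[OF S(1)] by blast
      moreover have "b' \<otimes> y [^] s = b" using b y by (simp add: b'_def m_assoc flip: int_pow_mult)
      ultimately show False using b by simp
    qed
    have "b' [^] int p = b [^] int p \<otimes> y [^] (- t)"
      using b y by (simp add: b'_def int_pow_distrib int_pow_pow s mult.commute)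
    also have "\<dots> = k" using k y by (simp add: bp m_assoc flip: int_pow_mult)
    finally have b'p: "b' [^] int p \<in> K" using k by simp
    note L = adj[OF b'] and L_iff = adj_iff[OF b']
    \<comment> \<open>Adjoining \<open>b'\<close> enlarges \<open>K\<close> properly, so by
      maximality the larger subgroup contains \<open>x\<close>.\<close>
    have "x \<in> K <#> generate G {b'}"
    proof (rule ccontr)
      assume "x \<notin> K <#> generate G {b'}"
      then have "K <#> generate G {b'} = K"
        using L K by (intro max) (auto simp: F_def)
      then show False using L b'S S(2) by auto
    qed
    then obtain k' and u :: int where k': "k' \<in> K" and xu: "x = k' \<otimes> b' [^] u"
      unfolding L_iff by blast
    \<comment> \<open>If \<open>p\<close> divides \<open>u\<close>, then \<open>b' [^] u\<close> and
      with it \<open>x\<close> lie in \<open>K\<close>. Otherwise \<open>b' [^] u\<close> and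
      \<open>b' [^] int p\<close> both lie in \<open>S\<close>, with coprime exponents, and so does
      \<open>b'\<close>.\<close>
    show False
    proof (cases "int p dvd u")
      case True
      then obtain v where "u = int p * v" by blast
      then have "b' [^] u = (b' [^] int p) [^] v" using b' by (simp add: int_pow_pow)
      then have "b' [^] u \<in> K" using Kpow[OF b'p] by simp
      then show False using K(3) k' by (simp add: xu)
    next
      case False
      then have "coprime (int p) u" using \<open>prime p\<close> by (simp add: prime_imp_coprime)
      moreover have "b' [^] u = inv k' \<otimes> x"
        using k' b' xc by (simp add: inv_solve_left xu)
      then have "b' [^] u \<in> S"
        using k' S(2) xS subgroup.m_closed[OF S(1)] K.m_inv_closed by auto
      ultimately show False
        using int_pow_coprime_mem[OF S(1) b'] b'p S(2) b'S by blast
    qed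
  qed
  then show ?thesis
    using K unfolding S_iff x_def by (intro exI[of _ K]) auto
qed

text \<open>
  The automorphism is \<open>e \<mapsto> e (z y\<inverse>)\<^bsup>\<chi> e\<^esup>\<close>, where \<open>\<chi> e\<close>, determined modulo \<open>p^(h + 1)\<close>, is the exponent
  of \<open>y\<close> in the decomposition of \<open>e\<close>.
\<close>

lemma (in comm_group) automorphism_of_cyclic_complement:
  assumes "prime p" and fin: "finite (carrier G)" and K: "subgroup K G"
    and pow: "\<And>a. a \<in> carrier G \<Longrightarrow> a [^] (int p ^ Suc h) \<in> K"
    and y: "y \<in> carrier G" "y [^] (int p ^ h) \<notin> K" "y [^] (int p ^ Suc h) = \<one>"
    and z: "z \<in> carrier G" "z [^] (int p ^ h) \<notin> K" "z [^] (int p ^ Suc h) = \<one>"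
    and dec: "\<And>e. e \<in> carrier G \<Longrightarrow> \<exists>k\<in>K. \<exists>t::int. e = k \<otimes> y [^] t"
  shows "\<exists>\<alpha>\<in>iso G G. \<alpha> (y [^] (int p ^ h)) = z [^] (int p ^ h)"
proof -
  let ?q = "int p ^ Suc h"
  interpret K: subgroup K G by fact
  have "\<exists>t::int. e \<otimes> y [^] (- t) \<in> K" if "e \<in> carrier G" for e
  proof -
    obtain k and t :: int where "k \<in> K" "e = k \<otimes> y [^] t" using dec[OF \<open>e \<in> carrier G\<close>] by blast
    then have "e \<otimes> y [^] (- t) = k" using y by (simp add: m_assoc flip: int_pow_mult)
    with \<open>k \<in> K\<close> show ?thesis by auto
  qed
  \<comment> \<open>The values of \<chi> are chosen independently of each other; \<chi> is additive
    only modulo \<open>p^(h+1)\<close>. This suffices because \<chi> enters only as an exponent of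
    \<open>w\<close>, whose \<open>p^(h+1)\<close>-th power is trivial.\<close>
  then obtain \<chi> :: "'a \<Rightarrow> int" where \<chi>: "\<And>e. e \<in> carrier G \<Longrightarrow> e \<otimes> y [^] (- \<chi> e) \<in> K" by metis
  have \<chi>_unique: "?q dvd \<chi> e - t" if e: "e \<in> carrier G" and t: "e \<otimes> y [^] (- t) \<in> K" for e t
  proof (rule int_pow_minimal_exponent[OF \<open>prime p\<close> K y(1) pow[OF y(1)] y(2)])
    have "(e \<otimes> y [^] (- \<chi> e)) \<otimes> y [^] (\<chi> e - t) = e \<otimes> y [^] (- t)"
      using e y by (simp add: m_assoc flip: int_pow_mult)
    then have "y [^] (\<chi> e - t) = inv (e \<otimes> y [^] (- \<chi> e)) \<otimes> (e \<otimes> y [^] (- t))"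
      using e y by (simp add: inv_solve_left)
    also have "\<dots> \<in> K" using \<chi>[OF e] t by simp
    finally show "y [^] (\<chi> e - t) \<in> K" .
  qed
  define w where "w = z \<otimes> inv y"
  have w: "w \<in> carrier G" "w [^] ?q = \<one>"
    using y z by (simp_all add: w_def int_pow_distrib int_pow_inv del: power_Suc)
  have w_pow: "w [^] s = w [^] t" if dvd: "?q dvd s - t" for s t :: int
  proof -
    obtain r where "s - t = ?q * r" using dvd unfolding dvd_def by blast
    then have "s = t + ?q * r" by simp
    then have "w [^] s = w [^] t \<otimes> (w [^] ?q) [^] r" using w(1) by (simp only: int_pow_mult int_pow_pow)
    then show ?thesis using w by simp
  qed
  define \<alpha> where "\<alpha> e = e \<otimes> w [^] \<chi> e" for e
  have hom: "\<alpha> \<in> hom G G"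
  proof (rule homI)
    fix a b assume ab: "a \<in> carrier G" "b \<in> carrier G"
    have "a \<otimes> b \<otimes> y [^] (- (\<chi> a + \<chi> b)) = (a \<otimes> y [^] (- \<chi> a)) \<otimes> (b \<otimes> y [^] (- \<chi> b))"
      using ab y by (simp add: int_pow_neg int_pow_diff m_ac)
    then have "?q dvd \<chi> (a \<otimes> b) - (\<chi> a + \<chi> b)"
      using ab \<chi>[OF ab(1)] \<chi>[OF ab(2)] by (intro \<chi>_unique) auto
    then have "w [^] \<chi> (a \<otimes> b) = w [^] (\<chi> a + \<chi> b)" by (rule w_pow)
    then show "\<alpha> (a \<otimes> b) = \<alpha> a \<otimes> \<alpha> b"
      using ab w by (simp add: \<alpha>_def int_pow_mult m_ac)
  qed (use w in \<open>simp add: \<alpha>_def\<close>)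
  interpret \<alpha>: group_hom G G \<alpha> using hom by unfold_locales
  have z_pow: "z [^] t = w [^] t \<otimes> y [^] t" for t :: int
    using y z w by (simp add: w_def m_assoc flip: int_pow_distrib)
  \<comment> \<open>On the kernel of \<alpha>, \<open>z [^] \<chi> e\<close> is the inverse of the
    \<open>K\<close>-part of \<open>e\<close>. As \<open>z\<close> has order \<open>p^(h+1)\<close>
    modulo \<open>K\<close>, \<chi> vanishes there modulo \<open>p^(h+1)\<close>, and then \<alpha>
    fixes \<open>e\<close>.\<close>
  have "e = \<one>" if e: "e \<in> carrier G" "\<alpha> e = \<one>" for e
  proof -
    have w_inv: "w [^] \<chi> e = inv e"
      using e w by (intro inv_equality[symmetric]) (simp_all add: \<alpha>_def m_comm)
    then have "z [^] \<chi> e = inv (e \<otimes> y [^] (- \<chi> e))"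
      using e y by (simp add: z_pow int_pow_neg inv_mult)
    then have "z [^] \<chi> e \<in> K" using \<chi>[OF e(1)] by (simp add: K.m_inv_closed)
    then have "?q dvd \<chi> e"
      using int_pow_minimal_exponent[OF \<open>prime p\<close> K z(1) pow[OF z(1)] z(2)] by blast
    then have "w [^] \<chi> e = w [^] (0::int)" by (intro w_pow) simp
    then show "e = \<one>" using e w_inv by (simp add: inv_eq_1_iff)
  qed
  then have inj: "inj_on \<alpha> (carrier G)" by (simp add: \<alpha>.inj_on_one_iff)
  moreover have "\<alpha> ` carrier G = carrier G"
    using inj fin by (intro endo_inj_surj) auto
  ultimately have "\<alpha> \<in> iso G G" using hom by (simp add: iso_def bij_betw_def)
  \<comment> \<open>The \<open>K\<close>-part of \<open>y [^] (int p ^ h)\<close> may be taken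
    trivial, so \<alpha> multiplies this element by \<open>w [^] (int p ^ h)\<close>.\<close>
  moreover have "?q dvd \<chi> (y [^] (int p ^ h)) - int p ^ h"
    using y by (intro \<chi>_unique) (simp_all flip: int_pow_mult)
  then have "w [^] \<chi> (y [^] (int p ^ h)) = w [^] (int p ^ h)" by (rule w_pow)
  then have "\<alpha> (y [^] (int p ^ h)) = z [^] (int p ^ h)"
    using y w by (simp add: \<alpha>_def z_pow m_comm)
  ultimately show ?thesis by blast
qed

section \<open>Heights and automorphisms\<close>

lemma (in comm_group) subgroup_int_pow_image:
  "subgroup ((\<lambda>a. a [^] (k::int)) ` carrier G) G"
proof -
  have "(\<lambda>a. a [^] k) \<in> hom G G" by (auto intro!: homI simp: int_pow_distrib)
  then interpret group_hom G G "\<lambda>a. a [^] k" by unfold_locales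
  show ?thesis by (rule img_is_subgroup)
qed

text \<open>Let \<open>h\<close> be the common height and \<open>x = y [^] (int p ^ h)\<close>. A
  complement \<open>K\<close> of the group generated by \<open>y\<close> that contains all
  \<open>p^(h+1)\<close>-th powers yields automorphisms from \<open>x\<close> to every element of
  order \<open>p\<close> and height \<open>h\<close> outside \<open>K\<close>. The same holds for
  \<open>x'\<close> with a complement \<open>K'\<close>, and the two are linked by an element
  outside both.\<close>

lemma (in comm_group) exists_automorphism_of_equal_heights:
  assumes "prime p" and fin: "finite (carrier G)"
    and ord: "\<And>a. a \<in> carrier G \<Longrightarrow> a [^] (int p ^ n) = \<one>"
    and x: "x \<in> carrier G" "x \<noteq> \<one>" "x [^] int p = \<one>"
    and x': "x' \<in> carrier G" "x' \<noteq> \<one>" "x' [^] int p = \<one>"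
    and height: "\<And>k. x \<in> (\<lambda>a. a [^] (int p ^ k)) ` carrier G \<longleftrightarrow>
      x' \<in> (\<lambda>a. a [^] (int p ^ k)) ` carrier G"
  shows "\<exists>\<alpha>\<in>iso G G. \<alpha> x = x'"
proof -
  define P where "P k = (\<lambda>a. a [^] (int p ^ k)) ` carrier G" for k
  have P: "subgroup (P k) G" for k unfolding P_def by (rule subgroup_int_pow_image)
  have "P n \<subseteq> {\<one>}" using ord by (auto simp: P_def)
  then have "\<exists>k. x \<notin> P k" using x by blast
  then obtain k where k: "x \<notin> P k" "\<And>i. i < k \<Longrightarrow> x \<in> P i"
    using exists_least_iff[of "\<lambda>k. x \<notin> P k"] by blast
  \<comment> \<open>\<open>P 0\<close> is the whole group, so the least \<open>k\<close> with
    \<open>x \<notin> P k\<close> is positive, and its predecessor \<open>h\<close> is the height of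
    \<open>x\<close>.\<close>
  have "k \<noteq> 0" using k(1) x(1) by (intro notI) (simp add: P_def)
  then obtain h where h: "k = Suc h" using not0_implies_Suc by blast
  define good where "good u \<longleftrightarrow> u \<in> P h \<and> u \<notin> P (Suc h) \<and> u [^] int p = \<one>" for u
  have good: "good x" "good x'"
    using k x x' height[folded P_def] by (simp_all add: good_def h)
  have good_carrier: "u \<in> carrier G" if "good u" for u
    using that subgroup.mem_carrier[OF P] by (auto simp: good_def)
  have root: "\<exists>y\<in>carrier G. u = y [^] (int p ^ h) \<and> y [^] (int p ^ Suc h) = \<one>" if u: "good u" for u
  proof -
    obtain y where y: "y \<in> carrier G" "u = y [^] (int p ^ h)"
      using u by (auto simp: good_def P_def)
    then have "y [^] (int p ^ Suc h) = u [^] int p" by (simp add: int_pow_pow mult.commute)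
    then show ?thesis using y u by (auto simp: good_def)
  qed
  \<comment> \<open>One \<open>K\<close> serves all \<open>v\<close>, so that the target can be
    selected after \<open>K\<close> is known.\<close>
  have step: "\<exists>K. subgroup K G \<and> P (Suc h) \<subseteq> K \<and> u \<notin> K \<and>
      (\<forall>v. good v \<longrightarrow> v \<notin> K \<longrightarrow> (\<exists>\<alpha>\<in>iso G G. \<alpha> u = v))" if u: "good u" for u
  proof -
    obtain y where y: "y \<in> carrier G" "u = y [^] (int p ^ h)" "y [^] (int p ^ Suc h) = \<one>"
      using root[OF u] by blast
    have top: "y [^] (int p ^ h) \<notin> P (Suc h)" using u y by (simp add: good_def)
    have pow: "a [^] (int p ^ Suc h) \<in> P (Suc h)" if "a \<in> carrier G" for a
      using that by (auto simp: P_def simp del: power_Suc)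
    obtain K where K: "subgroup K G" "P (Suc h) \<subseteq> K" "y [^] (int p ^ h) \<notin> K"
      "\<And>e. e \<in> carrier G \<Longrightarrow> \<exists>k\<in>K. \<exists>t::int. e = k \<otimes> y [^] t"
      using avoiding_subgroup_with_cyclic_quotient[OF \<open>prime p\<close> fin ord P pow y(1) top] by blast
    have "\<exists>\<alpha>\<in>iso G G. \<alpha> u = v" if v: "good v" "v \<notin> K" for v
    proof -
      obtain z where z: "z \<in> carrier G" "v = z [^] (int p ^ h)" "z [^] (int p ^ Suc h) = \<one>"
        using root[OF v(1)] by blast
      have "a [^] (int p ^ Suc h) \<in> K" if "a \<in> carrier G" for a
        using pow[OF that] K(2) by blast
      then show ?thesis
        using automorphism_of_cyclic_complement[OF \<open>prime p\<close> fin K(1) _ y(1) K(3) y(3) z(1) _ z(3) K(4)]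
          v z(2) y(2) by simp
    qed
    then show ?thesis using K y(2) by blast
  qed
  obtain K where K: "subgroup K G" "P (Suc h) \<subseteq> K" "x \<notin> K"
    "\<And>v. good v \<Longrightarrow> v \<notin> K \<Longrightarrow> \<exists>\<alpha>\<in>iso G G. \<alpha> x = v" using step[OF good(1)] by blast
  obtain K' where K': "subgroup K' G" "P (Suc h) \<subseteq> K'" "x' \<notin> K'"
    "\<And>v. good v \<Longrightarrow> v \<notin> K' \<Longrightarrow> \<exists>\<alpha>\<in>iso G G. \<alpha> x' = v" using step[OF good(2)] by blast
  have via: "\<exists>\<alpha>\<in>iso G G. \<alpha> x = x'" if w: "good w" "w \<notin> K" "w \<notin> K'" for w
  proof -
    obtain \<alpha> where \<alpha>: "\<alpha> \<in> iso G G" "\<alpha> x = w" using K(4) w by blast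
    obtain \<beta> where \<beta>: "\<beta> \<in> iso G G" "\<beta> x' = w" using K'(4) w by blast
    have "inv_into (carrier G) \<beta> w = x'"
      using \<beta> x'(1) by (auto simp: iso_def bij_betw_def)
    then show ?thesis
      using iso_set_trans[OF \<alpha>(1) iso_set_sym[OF \<beta>(1)]] \<alpha>(2)
      by (intro bexI[of _ "inv_into (carrier G) \<beta> \<circ> \<alpha>"]) auto
  qed
  \<comment> \<open>If \<open>x' \<in> K\<close> and \<open>x \<in> K'\<close>, then \<open>x \<otimes> x'\<close> lies outside both subgroups, and one goes from \<open>x\<close> to
    \<open>x'\<close> through it.\<close>
  consider "x' \<notin> K" | "x \<notin> K'" | "x' \<in> K" "x \<in> K'" by blast
  then show ?thesis
  proof cases
    case 1
    then show ?thesis using K(4) good by blast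
  next
    case 2
    \<comment> \<open>\<open>x\<close> itself lies outside both subgroups and is the intermediate
      element.\<close>
    then show ?thesis using via good K by blast
  next
    case 3
    have w: "x \<otimes> x' \<notin> K" "x \<otimes> x' \<notin> K'"
    proof -
      have "x = (x \<otimes> x') \<otimes> inv x'" using x x' by (simp add: m_assoc)
      then show "x \<otimes> x' \<notin> K"
        using 3 K(1,3) subgroup.m_closed subgroup.m_inv_closed by metis
      have "x' = (x \<otimes> x') \<otimes> inv x" using x x' by (simp add: m_comm[of x] m_assoc)
      then show "x \<otimes> x' \<notin> K'"
        using 3 K'(1,3) subgroup.m_closed subgroup.m_inv_closed by metis
    qed
    \<comment> \<open>The height does not exceed \<open>h\<close>, because \<open>P (Suc h)\<close>
      is contained in \<open>K\<close> and the product is not in \<open>K\<close>.\<close>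
    moreover have "good (x \<otimes> x')"
      using good w(1) K(2) x x' subgroup.m_closed[OF P[of h]]
      by (auto simp: good_def int_pow_distrib)
    ultimately show ?thesis by (intro via)
  qed
qed

section \<open>Kernels of order \<open>p\<close>\<close>

text \<open>The nonempty fibres of \<open>h\<close> on \<open>S\<close> are cosets of
  \<open>S \<inter> kernel G H h\<close>.\<close>

lemma (in group_hom) card_subgroup_eq_image_times_kernel:
  assumes fin: "finite (carrier G)" and S: "subgroup S G"
  shows "card S = card (h ` S) * card (S \<inter> kernel G H h)"
proof -
  interpret S: subgroup S G by fact
  have finS: "finite S" using fin S.subset finite_subset by blast
  have "card {s \<in> S. h s = y} = card (S \<inter> kernel G H h)" if "y \<in> h ` S" for y
  proof -
    obtain a where a: "a \<in> S" "y = h a" using \<open>y \<in> h ` S\<close> by blast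
    have "bij_betw (\<lambda>k. a \<otimes> k) (S \<inter> kernel G H h) {s \<in> S. h s = y}"
    proof (rule bij_betw_byWitness[where f' = "\<lambda>s. inv a \<otimes> s"])
      show "(\<otimes>) a ` (S \<inter> kernel G H h) \<subseteq> {s \<in> S. h s = y}"
        using a by (auto simp: kernel_def)
      show "(\<otimes>) (inv a) ` {s \<in> S. h s = y} \<subseteq> S \<inter> kernel G H h"
        using a by (auto simp: kernel_def)
    qed (use a in \<open>auto simp flip: G.m_assoc\<close>)
    then show ?thesis by (simp add: bij_betw_same_card)
  qed
  then have "(\<Sum>y\<in>h ` S. card {s \<in> S. h s = y}) = card (h ` S) * card (S \<inter> kernel G H h)"
    by simp
  moreover have "card S = (\<Sum>y\<in>h ` S. card {s \<in> S. h s = y})"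
    using sum.image_gen[OF finS, of "\<lambda>_. 1::nat" h] by simp
  ultimately show ?thesis by simp
qed

text \<open>By Lagrange \<open>S \<inter> H\<close> has order 1 or \<open>p\<close>. Membership of
  one nontrivial element of \<open>H\<close> can therefore be decided by counting.\<close>

lemma (in group) prime_card_subgroup_mem_iff:
  assumes "prime p" and H: "subgroup H G" "card H = p" and S: "subgroup S G"
    and x: "x \<in> H" "x \<noteq> \<one>"
  shows "x \<in> S \<longleftrightarrow> card (S \<inter> H) = p" and "x \<in> S \<longleftrightarrow> H \<subseteq> S"
proof -
  interpret H: group "G\<lparr>carrier := H\<rparr>" by (rule subgroup_imp_group[OF H(1)])
  have finH: "finite H" using H(2) \<open>prime p\<close> prime_gt_0_nat by (metis card_ge_0_finite)
  have "subgroup (S \<inter> H) (G\<lparr>carrier := H\<rparr>)"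
    by (intro subgroup_incl subgroups_Inter_pair H S) auto
  then have "card (S \<inter> H) dvd order (G\<lparr>carrier := H\<rparr>)"
    using H.lagrange by (metis dvd_triv_right)
  then have dvd: "card (S \<inter> H) dvd p"
    using H(2) by (simp add: order_def)
  have "card (S \<inter> H) \<noteq> 1" if "x \<in> S"
  proof
    assume "card (S \<inter> H) = 1"
    moreover have "{x, \<one>} \<subseteq> S \<inter> H"
      using that x subgroup.one_closed[OF S] subgroup.one_closed[OF H(1)] by auto
    ultimately have "card {x, \<one>} \<le> 1" using finH by (metis card_mono finite_Int)
    then show False using x by simp
  qed
  then have 1: "card (S \<inter> H) = p" if "x \<in> S"
    using that dvd \<open>prime p\<close> by (metis prime_nat_iff)
  moreover have 2: "H \<subseteq> S" if "card (S \<inter> H) = p"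
    using that card_subset_eq[OF finH, of "S \<inter> H"] H(2) by auto
  ultimately show "x \<in> S \<longleftrightarrow> card (S \<inter> H) = p" "x \<in> S \<longleftrightarrow> H \<subseteq> S"
    using x by auto
qed

lemma (in group) prime_card_subgroup_pow:
  assumes H: "subgroup H G" "card H = p" "finite H" and x: "x \<in> H"
  shows "x [^] int p = \<one>"
proof -
  interpret H: group "G\<lparr>carrier := H\<rparr>" by (rule subgroup_imp_group[OF H(1)])
  have "x [^]\<^bsub>G\<lparr>carrier := H\<rparr>\<^esub> order (G\<lparr>carrier := H\<rparr>) = \<one>"
    using H.pow_order_eq_1 x by simp
  then show ?thesis
    using H(2) by (simp add: order_def int_pow_int flip: nat_pow_consistent)
qed

text \<open>In the application \<open>E\<close> is \<open>E_d\<close>, \<open>f\<close> is its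
  projection to \<open>G\<close>, and \<open>g\<close> is the projection of \<open>E_c\<close>
  transported along an isomorphism.\<close>

lemma exists_automorphism_between_kernels:
  assumes "prime p" and E: "group E" "finite (carrier E)" "order E = p ^ n" and G: "comm_group G"
    and f: "f \<in> hom E G" "f ` carrier E = carrier G" "card (kernel E G f) = p"
    and g: "g \<in> hom E G" "g ` carrier E = carrier G" "card (kernel E G g) = p"
  shows "\<exists>\<alpha>\<in>iso E E. \<alpha> ` kernel E G g = kernel E G f"
proof -
  interpret E: group E by fact
  interpret G: comm_group G by fact
  interpret f: group_hom E G f using f(1) by unfold_locales
  interpret g: group_hom E G g using g(1) by unfold_locales
  let ?M = "kernel E G f" and ?N = "kernel E G g"
  note M = f.subgroup_kernel and N = g.subgroup_kernel
  have fin: "finite ?M" "finite ?N" using E(2) by (auto simp: kernel_def)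
  have "1 < p" using \<open>prime p\<close> prime_gt_1_nat by blast
  have nontriv: "\<exists>x\<in>K. x \<noteq> \<one>\<^bsub>E\<^esub>" if "card K = p" for K :: "'a set"
  proof (rule ccontr)
    assume "\<not> ?thesis"
    then have "K \<subseteq> {\<one>\<^bsub>E\<^esub>}" by blast
    then have "card K \<le> 1" using card_mono[of "{\<one>\<^bsub>E\<^esub>}" K] by simp
    then show False using that \<open>1 < p\<close> by simp
  qed
  obtain x where x: "x \<in> ?N" "x \<noteq> \<one>\<^bsub>E\<^esub>" using nontriv[OF g(3)] by blast
  obtain x' where x': "x' \<in> ?M" "x' \<noteq> \<one>\<^bsub>E\<^esub>" using nontriv[OF f(3)] by blast
  note mem_N = E.prime_card_subgroup_mem_iff[OF \<open>prime p\<close> N g(3) _ x]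
  note mem_M = E.prime_card_subgroup_mem_iff[OF \<open>prime p\<close> M f(3) _ x']
  show ?thesis
  proof (cases "?M \<inter> ?N = {\<one>\<^bsub>E\<^esub>}")
    case False
    then obtain u where "u \<in> ?M" "u \<in> ?N" "u \<noteq> \<one>\<^bsub>E\<^esub>"
      using subgroup.one_closed[OF M] subgroup.one_closed[OF N] by blast
    then have "?M = ?N"
      using E.prime_card_subgroup_mem_iff(2)[OF \<open>prime p\<close>] M N f(3) g(3) by blast
    then show ?thesis using iso_set_refl[of E] by (intro bexI[of _ "\<lambda>x. x"]) auto
  next
    case True
    have "a \<otimes>\<^bsub>E\<^esub> b = b \<otimes>\<^bsub>E\<^esub> a" if ab: "a \<in> carrier E" "b \<in> carrier E" for a b
    proof -
      \<comment> \<open>Both \<open>f\<close> and \<open>g\<close> map into an abelian group, so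
        both kill this element.\<close>
      have "(a \<otimes>\<^bsub>E\<^esub> b) \<otimes>\<^bsub>E\<^esub> inv\<^bsub>E\<^esub> (b \<otimes>\<^bsub>E\<^esub> a) \<in> ?M \<inter> ?N"
        using ab by (simp add: kernel_def G.m_comm[of "f a"] G.m_comm[of "g a"])
      then have "(a \<otimes>\<^bsub>E\<^esub> b) \<otimes>\<^bsub>E\<^esub> inv\<^bsub>E\<^esub> (b \<otimes>\<^bsub>E\<^esub> a) = \<one>\<^bsub>E\<^esub>" unfolding True by simp
      then show ?thesis using ab by (metis E.inv_equality E.inv_inv E.m_closed E.inv_closed)
    qed
    then interpret E: comm_group E by unfold_locales
    define P where "P k = (\<lambda>a. a [^]\<^bsub>E\<^esub> (int p ^ k)) ` carrier E" for k
    have P: "subgroup (P k) E" for k unfolding P_def by (rule E.subgroup_int_pow_image)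
    have "x \<in> P k \<longleftrightarrow> x' \<in> P k" for k
    proof -
      \<comment> \<open>Both images are the group of \<open>p^k\<close>-th powers of
        \<open>G\<close>. Equal images force equal orders of the intersections of \<open>P k\<close>
        with the two kernels, and these orders decide whether \<open>x\<close> and \<open>x'\<close>
        lie in \<open>P k\<close>.\<close>
      have "f ` P k = (\<lambda>a. a [^]\<^bsub>G\<^esub> (int p ^ k)) ` f ` carrier E"
        unfolding P_def image_image by (intro image_cong) (simp_all add: f.hom_int_pow)
      moreover have "g ` P k = (\<lambda>a. a [^]\<^bsub>G\<^esub> (int p ^ k)) ` g ` carrier E"
        unfolding P_def image_image by (intro image_cong) (simp_all add: g.hom_int_pow)
      ultimately have "f ` P k = g ` P k" using f g by simp
      then have "card (f ` P k) * card (P k \<inter> ?M) = card (f ` P k) * card (P k \<inter> ?N)"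
        using f.card_subgroup_eq_image_times_kernel[OF E(2) P]
          g.card_subgroup_eq_image_times_kernel[OF E(2) P] by metis
      moreover have "card (f ` P k) \<noteq> 0"
        using E(2) E.one_closed by (auto simp: P_def)
      ultimately have "card (P k \<inter> ?M) = card (P k \<inter> ?N)" by simp
      then show ?thesis using mem_N(1)[OF P] mem_M(1)[OF P] by simp
    qed
    moreover have "a [^]\<^bsub>E\<^esub> (int p ^ n) = \<one>\<^bsub>E\<^esub>" if "a \<in> carrier E" for a
      using E.pow_order_eq_1[OF that] E(3) by (simp flip: int_pow_int of_nat_power)
    ultimately obtain \<alpha> where \<alpha>: "\<alpha> \<in> iso E E" "\<alpha> x = x'"
      using E.exists_automorphism_of_equal_heights[OF \<open>prime p\<close> E(2), of n x x']
        subgroup.mem_carrier[OF M x'(1)] subgroup.mem_carrier[OF N x(1)] x x'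
        E.prime_card_subgroup_pow[OF N g(3) fin(2) x(1)] E.prime_card_subgroup_pow[OF M f(3) fin(1) x'(1)]
      unfolding P_def by blast
    interpret \<alpha>: group_hom E E \<alpha> using \<alpha>(1) by unfold_locales (simp add: iso_def)
    have im: "subgroup (\<alpha> ` ?N) E" by (rule \<alpha>.subgroup_img_is_subgroup[OF N])
    \<comment> \<open>A subgroup that contains the nontrivial element \<open>x'\<close> contains all
      of the kernel of \<open>f\<close>, and the orders agree.\<close>
    have "x' \<in> \<alpha> ` ?N" using \<alpha>(2) x(1) by blast
    then have "?M \<subseteq> \<alpha> ` ?N" using mem_M(2)[OF im] by simp
    moreover have "card (\<alpha> ` ?N) \<le> card ?M" using card_image_le[OF fin(2)] f(3) g(3) by simp
    ultimately have "?M = \<alpha> ` ?N" using fin by (intro card_seteq) auto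
    then show ?thesis using \<alpha> by blast
  qed
qed

section \<open>Isomorphisms of central extensions\<close>

lemma hom_fst_central_extension:
  "fst \<in> hom (central_extension G R c) G"
  by (auto simp: hom_def central_extension_def)

lemma kernel_fst_central_extension:
  assumes "monoid G"
  shows "kernel (central_extension G R c) G fst = {\<one>\<^bsub>G\<^esub>} \<times> carrier R"
  using monoid.one_closed[OF assms] by (auto simp: kernel_def central_extension_def)

text \<open>If \<open>d\<close> is the twist of \<open>c\<close> by \<open>(\<sigma>, l)\<close>
  plus the coboundary of \<open>f\<close>, then \<open>(g, m)\<close> may be sent to
  \<open>(\<sigma> g, l m - f (\<sigma> g))\<close>: the second term absorbs the coboundary.\<close>

lemma central_extension_iso_of_twist:
  assumes "group G" and "cring R" and c: "c \<in> cocycles2 G R"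
    and a: "a \<in> carrier (acting_group G R)"
    and d_mem: "d \<in> cohomology_class G R (twist G R a c)"
  shows "central_extension G R c \<cong> central_extension G R d"
proof -
  interpret G: group G by fact
  interpret R: cring R by fact
  interpret A: group "AutoGroup G" by (rule G.AutoGroup)
  obtain \<sigma> l where a: "a = (\<sigma>, l)" "\<sigma> \<in> carrier (AutoGroup G)" "l \<in> Units R"
    using a by (auto simp: acting_group_def units_of_def)
  have l: "l \<in> carrier R" using a(3) by blast
  have \<sigma>: "\<sigma> \<in> hom G G" "bij_betw \<sigma> (carrier G) (carrier G)"
    using a(2) by (auto simp: AutoGroup_def auto_def Bij_def)
  have \<sigma>c: "\<sigma> x \<in> carrier G" if "x \<in> carrier G" for x
    using that \<sigma>(1) by (auto simp: hom_def)
  have inv_\<sigma>: "(inv\<^bsub>AutoGroup G\<^esub> \<sigma>) (\<sigma> x) = x" if "x \<in> carrier G" for x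
  proof -
    have "inv\<^bsub>AutoGroup G\<^esub> \<sigma> \<in> carrier (AutoGroup G)" using a(2) by simp
    then have "(inv\<^bsub>AutoGroup G\<^esub> \<sigma> \<otimes>\<^bsub>AutoGroup G\<^esub> \<sigma>) x = (inv\<^bsub>AutoGroup G\<^esub> \<sigma>) (\<sigma> x)"
      using that a(2) by (simp add: AutoGroup_def BijGroup_def auto_def compose_def)
    then show ?thesis
      using that a(2) by (simp add: A.l_inv) (simp add: AutoGroup_def BijGroup_def)
  qed
  obtain f where f: "f \<in> carrier G \<rightarrow>\<^sub>E carrier R"
    and d_eq: "d = coboundary1 G R f \<otimes>\<^bsub>Z2 G R\<^esub> twist G R a c"
    using d_mem by (auto simp: cohomology_class_def r_coset_def coboundaries2_def)
  have fc: "f x \<in> carrier R" if "x \<in> carrier G" for x using f that by auto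
  have cc: "c (x, y) \<in> carrier R" if "x \<in> carrier G" "y \<in> carrier G" for x y
    using that c by (auto simp: cocycles2_def)
  have d_val: "d (\<sigma> x, \<sigma> y) = f (\<sigma> y) \<ominus>\<^bsub>R\<^esub> f (\<sigma> (x \<otimes>\<^bsub>G\<^esub> y)) \<oplus>\<^bsub>R\<^esub> f (\<sigma> x) \<oplus>\<^bsub>R\<^esub> l \<otimes>\<^bsub>R\<^esub> c (x, y)"
    if "x \<in> carrier G" "y \<in> carrier G" for x y
    using that by (simp add: d_eq Z2_def coboundary1_def twist_def a(1) \<sigma>c inv_\<sigma> hom_mult[OF \<sigma>(1)])
  define \<phi> where "\<phi> = (\<lambda>(g, m). (\<sigma> g, l \<otimes>\<^bsub>R\<^esub> m \<ominus>\<^bsub>R\<^esub> f (\<sigma> g)))"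
  have expand: "l \<otimes>\<^bsub>R\<^esub> (m \<oplus>\<^bsub>R\<^esub> m' \<oplus>\<^bsub>R\<^esub> k) \<ominus>\<^bsub>R\<^esub> u
      = (l \<otimes>\<^bsub>R\<^esub> m \<ominus>\<^bsub>R\<^esub> v) \<oplus>\<^bsub>R\<^esub> (l \<otimes>\<^bsub>R\<^esub> m' \<ominus>\<^bsub>R\<^esub> w) \<oplus>\<^bsub>R\<^esub> (w \<ominus>\<^bsub>R\<^esub> u \<oplus>\<^bsub>R\<^esub> v \<oplus>\<^bsub>R\<^esub> l \<otimes>\<^bsub>R\<^esub> k)"
    if "m \<in> carrier R" "m' \<in> carrier R" "k \<in> carrier R" "u \<in> carrier R" "v \<in> carrier R"
      "w \<in> carrier R" for m m' k u v w
    using that l by algebra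
  have hom: "\<phi> \<in> hom (central_extension G R c) (central_extension G R d)"
    using l by (auto simp: hom_def \<phi>_def central_extension_def \<sigma>c fc cc d_val hom_mult[OF \<sigma>(1)]
        intro!: expand)
  have inv_l: "inv\<^bsub>R\<^esub> l \<in> carrier R" "l \<otimes>\<^bsub>R\<^esub> (inv\<^bsub>R\<^esub> l \<otimes>\<^bsub>R\<^esub> m) = m" "inv\<^bsub>R\<^esub> l \<otimes>\<^bsub>R\<^esub> (l \<otimes>\<^bsub>R\<^esub> m) = m"
    if "m \<in> carrier R" for m
    using that a(3) l by (simp_all flip: R.m_assoc)
  let ?\<psi> = "\<lambda>(g, m). (inv_into (carrier G) \<sigma> g, inv\<^bsub>R\<^esub> l \<otimes>\<^bsub>R\<^esub> (m \<oplus>\<^bsub>R\<^esub> f g))"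
  have inv_into: "inv_into (carrier G) \<sigma> g \<in> carrier G" "\<sigma> (inv_into (carrier G) \<sigma> g) = g"
    "inv_into (carrier G) \<sigma> (\<sigma> g) = g" if "g \<in> carrier G" for g
    using \<sigma>(2) that by (auto simp: bij_betw_def inv_into_into f_inv_into_f)
  have cancel: "m \<ominus>\<^bsub>R\<^esub> u \<oplus>\<^bsub>R\<^esub> u = m" "m \<oplus>\<^bsub>R\<^esub> u \<ominus>\<^bsub>R\<^esub> u = m"
    if "m \<in> carrier R" "u \<in> carrier R" for m u
    using that by algebra+
  have "bij_betw \<phi> (carrier (central_extension G R c)) (carrier (central_extension G R d))"
    using l by (intro bij_betw_byWitness[where f' = ?\<psi>])
      (auto simp: \<phi>_def central_extension_def inv_into inv_l \<sigma>c fc cancel)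
  with hom show ?thesis by (auto simp: is_iso_def iso_def)
qed

text \<open>Such an isomorphism has the form \<open>(g, m)\<close> to
  \<open>(\<sigma> g, r g + l m)\<close>, and multiplicativity then says that \<open>d\<close>
  composed with \<sigma> differs from \<open>l c\<close> by the coboundary of \<open>- r\<close>.
  The hypothesis \<open>additive\<close> supplies the factor \<open>l\<close>.\<close>

lemma twist_of_central_extension_iso:
  assumes "group G" and "cring R" and c: "c \<in> cocycles2 G R" and d: "d \<in> cocycles2 G R"
    and additive: "\<And>\<psi> m. \<psi> \<in> hom (add_monoid R) (add_monoid R) \<Longrightarrow> m \<in> carrier R \<Longrightarrow>
      \<psi> m = \<psi> \<one>\<^bsub>R\<^esub> \<otimes>\<^bsub>R\<^esub> m"
    and \<phi>: "\<phi> \<in> iso (central_extension G R c) (central_extension G R d)"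
    and \<phi>_kernel: "\<phi> ` ({\<one>\<^bsub>G\<^esub>} \<times> carrier R) = {\<one>\<^bsub>G\<^esub>} \<times> carrier R"
  shows "\<exists>a\<in>carrier (acting_group G R). d \<in> cohomology_class G R (twist G R a c)"
proof -
  interpret G: group G by fact
  interpret R: cring R by fact
  interpret A: group "AutoGroup G" by (rule G.AutoGroup)
  have one_right: "b (g, \<one>\<^bsub>G\<^esub>) = b (\<one>\<^bsub>G\<^esub>, \<one>\<^bsub>G\<^esub>)" if "b \<in> cocycles2 G R" "g \<in> carrier G" for b g
  proof -
    have b: "b (x, y) \<in> carrier R" if "x \<in> carrier G" "y \<in> carrier G" for x y
      using that \<open>b \<in> cocycles2 G R\<close> by (auto simp: cocycles2_def)
    have "b (\<one>\<^bsub>G\<^esub>, \<one>\<^bsub>G\<^esub>) \<oplus>\<^bsub>R\<^esub> b (g, \<one>\<^bsub>G\<^esub> \<otimes>\<^bsub>G\<^esub> \<one>\<^bsub>G\<^esub>) = b (g \<otimes>\<^bsub>G\<^esub> \<one>\<^bsub>G\<^esub>, \<one>\<^bsub>G\<^esub>) \<oplus>\<^bsub>R\<^esub> b (g, \<one>\<^bsub>G\<^esub>)"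
      using that unfolding cocycles2_def by blast
    then show ?thesis using b that by simp
  qed
  have cc: "c (x, y) \<in> carrier R" if "x \<in> carrier G" "y \<in> carrier G" for x y
    using that c by (auto simp: cocycles2_def)
  have dd: "d (x, y) \<in> carrier R" if "x \<in> carrier G" "y \<in> carrier G" for x y
    using that d by (auto simp: cocycles2_def)
  \<comment> \<open>The neutral elements are \<open>(1, - e)\<close> and \<open>(1, - e')\<close>,
    so the coefficients embed homomorphically by \<open>m\<close> to \<open>(1, m - e)\<close>; the
    shifts in \<psi> make it additive.\<close>
  define e where "e = c (\<one>\<^bsub>G\<^esub>, \<one>\<^bsub>G\<^esub>)"
  define e' where "e' = d (\<one>\<^bsub>G\<^esub>, \<one>\<^bsub>G\<^esub>)"
  have e: "e \<in> carrier R" "e' \<in> carrier R" by (simp_all add: e_def e'_def cc dd)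
  define \<sigma> where "\<sigma> g = fst (\<phi> (g, \<zero>\<^bsub>R\<^esub>))" for g
  define r where "r g = snd (\<phi> (g, \<zero>\<^bsub>R\<^esub>))" for g
  define \<psi> where "\<psi> m = snd (\<phi> (\<one>\<^bsub>G\<^esub>, m \<ominus>\<^bsub>R\<^esub> e)) \<oplus>\<^bsub>R\<^esub> e'" for m
  have \<phi>_mem: "\<phi> (g, m) \<in> carrier G \<times> carrier R" if "g \<in> carrier G" "m \<in> carrier R" for g m
    using \<phi> that by (auto simp: iso_def hom_def central_extension_def)
  have mem: "\<sigma> g \<in> carrier G" "r g \<in> carrier R" if "g \<in> carrier G" for g
    using \<phi>_mem[OF that R.zero_closed] by (auto simp: \<sigma>_def r_def)
  have \<psi>_mem: "\<psi> m \<in> carrier R" if "m \<in> carrier R" for m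
    using \<phi>_mem[OF G.one_closed, of "m \<ominus>\<^bsub>R\<^esub> e"] e that by (auto simp: \<psi>_def)
  have \<phi>_mult: "\<phi> (g \<otimes>\<^bsub>G\<^esub> h, m \<oplus>\<^bsub>R\<^esub> k \<oplus>\<^bsub>R\<^esub> c (g, h))
      = (fst (\<phi> (g, m)) \<otimes>\<^bsub>G\<^esub> fst (\<phi> (h, k)),
         snd (\<phi> (g, m)) \<oplus>\<^bsub>R\<^esub> snd (\<phi> (h, k)) \<oplus>\<^bsub>R\<^esub> d (fst (\<phi> (g, m)), fst (\<phi> (h, k))))"
    if "g \<in> carrier G" "h \<in> carrier G" "m \<in> carrier R" "k \<in> carrier R" for g h m k
    using \<phi> that by (force simp: iso_def hom_def central_extension_def split_beta)
  have \<phi>_one: "\<phi> (\<one>\<^bsub>G\<^esub>, m \<ominus>\<^bsub>R\<^esub> e) = (\<one>\<^bsub>G\<^esub>, \<psi> m \<ominus>\<^bsub>R\<^esub> e')" if m: "m \<in> carrier R" for m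
  proof -
    have "\<phi> (\<one>\<^bsub>G\<^esub>, m \<ominus>\<^bsub>R\<^esub> e) \<in> \<phi> ` ({\<one>\<^bsub>G\<^esub>} \<times> carrier R)"
      using m e by simp
    then have "\<phi> (\<one>\<^bsub>G\<^esub>, m \<ominus>\<^bsub>R\<^esub> e) \<in> {\<one>\<^bsub>G\<^esub>} \<times> carrier R" by (simp only: \<phi>_kernel)
    moreover have "s \<oplus>\<^bsub>R\<^esub> e' \<ominus>\<^bsub>R\<^esub> e' = s" if "s \<in> carrier R" for s
      using that e by algebra
    ultimately show ?thesis by (auto simp: \<psi>_def)
  qed
  have \<psi>_hom: "\<psi> \<in> hom (add_monoid R) (add_monoid R)"
  proof (rule homI)
    fix m k assume "m \<in> carrier (add_monoid R)" "k \<in> carrier (add_monoid R)"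
    then have mk: "m \<in> carrier R" "k \<in> carrier R" by simp_all
    have "(m \<ominus>\<^bsub>R\<^esub> e) \<oplus>\<^bsub>R\<^esub> (k \<ominus>\<^bsub>R\<^esub> e) \<oplus>\<^bsub>R\<^esub> e = (m \<oplus>\<^bsub>R\<^esub> k) \<ominus>\<^bsub>R\<^esub> e"
      using mk e by algebra
    then have "\<phi> (\<one>\<^bsub>G\<^esub>, (m \<oplus>\<^bsub>R\<^esub> k) \<ominus>\<^bsub>R\<^esub> e) = (\<one>\<^bsub>G\<^esub>, (\<psi> m \<ominus>\<^bsub>R\<^esub> e') \<oplus>\<^bsub>R\<^esub> (\<psi> k \<ominus>\<^bsub>R\<^esub> e') \<oplus>\<^bsub>R\<^esub> e')"
      using \<phi>_mult[OF G.one_closed G.one_closed, of "m \<ominus>\<^bsub>R\<^esub> e" "k \<ominus>\<^bsub>R\<^esub> e"] mk e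
      by (simp add: \<phi>_one flip: e_def e'_def)
    then have "\<psi> (m \<oplus>\<^bsub>R\<^esub> k) = (\<psi> m \<ominus>\<^bsub>R\<^esub> e') \<oplus>\<^bsub>R\<^esub> (\<psi> k \<ominus>\<^bsub>R\<^esub> e') \<oplus>\<^bsub>R\<^esub> e' \<oplus>\<^bsub>R\<^esub> e'"
      by (simp add: \<psi>_def[of "m \<oplus>\<^bsub>R\<^esub> k"])
    also have "\<dots> = \<psi> m \<oplus>\<^bsub>R\<^esub> \<psi> k"
      using \<psi>_mem[OF mk(1)] \<psi>_mem[OF mk(2)] e by algebra
    finally show "\<psi> (m \<otimes>\<^bsub>add_monoid R\<^esub> k) = \<psi> m \<otimes>\<^bsub>add_monoid R\<^esub> \<psi> k" by simp
  qed (simp add: \<psi>_mem)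
  define l where "l = \<psi> \<one>\<^bsub>R\<^esub>"
  have l: "l \<in> carrier R" by (simp add: l_def \<psi>_mem)
  have \<psi>_eq: "\<psi> m = l \<otimes>\<^bsub>R\<^esub> m" if "m \<in> carrier R" for m
    unfolding l_def by (rule additive[OF \<psi>_hom that])
  \<comment> \<open>Since \<phi> maps onto the kernel, \<psi>, which is multiplication by
    \<open>l\<close>, attains the value 1.\<close>
  have "l \<in> Units R"
  proof -
    have "(\<one>\<^bsub>G\<^esub>, \<one>\<^bsub>R\<^esub> \<ominus>\<^bsub>R\<^esub> e') \<in> \<phi> ` ({\<one>\<^bsub>G\<^esub>} \<times> carrier R)"
      using e by (simp add: \<phi>_kernel)
    then obtain s where s: "s \<in> carrier R" "\<phi> (\<one>\<^bsub>G\<^esub>, s) = (\<one>\<^bsub>G\<^esub>, \<one>\<^bsub>R\<^esub> \<ominus>\<^bsub>R\<^esub> e')" by auto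
    have "s \<oplus>\<^bsub>R\<^esub> e \<ominus>\<^bsub>R\<^esub> e = s" "\<one>\<^bsub>R\<^esub> \<ominus>\<^bsub>R\<^esub> e' \<oplus>\<^bsub>R\<^esub> e' = \<one>\<^bsub>R\<^esub>" using s e by algebra+
    then have "l \<otimes>\<^bsub>R\<^esub> (s \<oplus>\<^bsub>R\<^esub> e) = \<one>\<^bsub>R\<^esub>"
      using s e by (simp add: \<psi>_def flip: \<psi>_eq)
    then show ?thesis
      using l s e R.m_comm[OF l] by (auto simp: Units_def)
  qed
  have \<phi>_eq: "\<phi> (g, m) = (\<sigma> g, r g \<oplus>\<^bsub>R\<^esub> l \<otimes>\<^bsub>R\<^esub> m)" if gm: "g \<in> carrier G" "m \<in> carrier R" for g m
  proof -
    \<comment> \<open>This is the factorisation of \<open>(g, m)\<close> as \<open>(g, 0)\<close>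
      times \<open>(1, m - e)\<close>, using \<open>c (g, 1) = e\<close>.\<close>
    have "\<zero>\<^bsub>R\<^esub> \<oplus>\<^bsub>R\<^esub> (m \<ominus>\<^bsub>R\<^esub> e) \<oplus>\<^bsub>R\<^esub> e = m" using gm e by algebra
    then have "\<phi> (g, m) = (\<sigma> g, r g \<oplus>\<^bsub>R\<^esub> (\<psi> m \<ominus>\<^bsub>R\<^esub> e') \<oplus>\<^bsub>R\<^esub> e')"
      using \<phi>_mult[OF gm(1) G.one_closed R.zero_closed, of "m \<ominus>\<^bsub>R\<^esub> e"] gm e mem
      by (simp add: \<phi>_one one_right[OF c] one_right[OF d] flip: e_def e'_def \<sigma>_def r_def)
    moreover have "r g \<oplus>\<^bsub>R\<^esub> (\<psi> m \<ominus>\<^bsub>R\<^esub> e') \<oplus>\<^bsub>R\<^esub> e' = r g \<oplus>\<^bsub>R\<^esub> \<psi> m"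
      using mem(2)[OF gm(1)] \<psi>_mem[OF gm(2)] e by algebra
    ultimately show ?thesis using \<psi>_eq gm by simp
  qed
  have "(\<sigma> (g \<otimes>\<^bsub>G\<^esub> h), r (g \<otimes>\<^bsub>G\<^esub> h) \<oplus>\<^bsub>R\<^esub> l \<otimes>\<^bsub>R\<^esub> c (g, h))
      = (\<sigma> g \<otimes>\<^bsub>G\<^esub> \<sigma> h, r g \<oplus>\<^bsub>R\<^esub> r h \<oplus>\<^bsub>R\<^esub> d (\<sigma> g, \<sigma> h))"
    if "g \<in> carrier G" "h \<in> carrier G" for g h
    using \<phi>_mult[OF that R.zero_closed R.zero_closed] that
    by (simp add: cc \<phi>_eq[of "g \<otimes>\<^bsub>G\<^esub> h"] flip: \<sigma>_def r_def)
  then have \<sigma>_mult: "\<sigma> (g \<otimes>\<^bsub>G\<^esub> h) = \<sigma> g \<otimes>\<^bsub>G\<^esub> \<sigma> h"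
    and d_rel: "r (g \<otimes>\<^bsub>G\<^esub> h) \<oplus>\<^bsub>R\<^esub> l \<otimes>\<^bsub>R\<^esub> c (g, h) = r g \<oplus>\<^bsub>R\<^esub> r h \<oplus>\<^bsub>R\<^esub> d (\<sigma> g, \<sigma> h)"
    if "g \<in> carrier G" "h \<in> carrier G" for g h
    using that by blast+
  have \<sigma>_hom: "\<sigma> \<in> hom G G" by (auto intro: homI simp: mem \<sigma>_mult)
  interpret \<sigma>: group_hom G G \<sigma> using \<sigma>_hom by unfold_locales
  have "g = \<one>\<^bsub>G\<^esub>" if g: "g \<in> carrier G" "\<sigma> g = \<one>\<^bsub>G\<^esub>" for g
  proof -
    have "\<phi> (g, \<zero>\<^bsub>R\<^esub>) \<in> \<phi> ` ({\<one>\<^bsub>G\<^esub>} \<times> carrier R)"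
      unfolding \<phi>_kernel using \<phi>_mem[OF g(1) R.zero_closed] g by (auto simp: \<sigma>_def mem_Times_iff)
    then obtain m where m: "m \<in> carrier R" "\<phi> (g, \<zero>\<^bsub>R\<^esub>) = \<phi> (\<one>\<^bsub>G\<^esub>, m)" by auto
    have "inj_on \<phi> (carrier G \<times> carrier R)"
      using \<phi> by (simp add: iso_def bij_betw_def central_extension_def)
    then show ?thesis using m g by (auto dest: inj_onD)
  qed
  then have "inj_on \<sigma> (carrier G)" by (simp add: \<sigma>.inj_on_one_iff)
  moreover have "\<sigma> ` carrier G = carrier G"
  proof
    show "carrier G \<subseteq> \<sigma> ` carrier G"
    proof
      fix y assume "y \<in> carrier G"
      then have "(y, \<zero>\<^bsub>R\<^esub>) \<in> \<phi> ` (carrier G \<times> carrier R)"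
        using \<phi> by (simp add: iso_def bij_betw_def central_extension_def)
      then show "y \<in> \<sigma> ` carrier G" by (auto simp: \<phi>_eq)
    qed
  qed (use mem in auto)
  ultimately have \<sigma>_bij: "bij_betw \<sigma> (carrier G) (carrier G)" by (simp add: bij_betw_def)
  \<comment> \<open>Members of \<open>AutoGroup G\<close> are extensional, hence the
    restriction.\<close>
  define s where "s = restrict \<sigma> (carrier G)"
  have s: "s \<in> carrier (AutoGroup G)"
    using \<sigma>_hom \<sigma>_bij
    by (auto simp: s_def AutoGroup_def auto_def Bij_def hom_def bij_betw_restrict_eq
        cong: bij_betw_cong)
  define \<tau> where "\<tau> = inv\<^bsub>AutoGroup G\<^esub> s"
  have \<tau>: "\<tau> \<in> carrier (AutoGroup G)" using s by (simp add: \<tau>_def)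
  then have \<tau>_mem: "\<tau> x \<in> carrier G" and \<tau>_mult: "\<tau> (x \<otimes>\<^bsub>G\<^esub> y) = \<tau> x \<otimes>\<^bsub>G\<^esub> \<tau> y"
    if "x \<in> carrier G" "y \<in> carrier G" for x y
    using that by (auto simp: AutoGroup_def auto_def hom_def)
  have \<sigma>\<tau>: "\<sigma> (\<tau> x) = x" if x: "x \<in> carrier G" for x
  proof -
    have "(s \<otimes>\<^bsub>AutoGroup G\<^esub> \<tau>) x = s (\<tau> x)"
      using x s \<tau> by (simp add: AutoGroup_def BijGroup_def auto_def compose_def)
    moreover have "(s \<otimes>\<^bsub>AutoGroup G\<^esub> \<tau>) x = x"
      using x s by (simp add: \<tau>_def A.r_inv) (simp add: AutoGroup_def BijGroup_def)
    ultimately show ?thesis using x \<tau>_mem by (simp add: s_def)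
  qed
  \<comment> \<open>Solving \<open>d_rel\<close> at \<open>(\<tau> x, \<tau> y)\<close> for
    \<open>d (x, y)\<close> leaves exactly the coboundary of this function next to the
    twist.\<close>
  define f where "f = (\<lambda>x\<in>carrier G. \<ominus>\<^bsub>R\<^esub> r (\<tau> x))"
  have f: "f \<in> carrier G \<rightarrow>\<^sub>E carrier R" by (auto simp: f_def mem \<tau>_mem)
  have "d (x, y) = (f y \<ominus>\<^bsub>R\<^esub> f (x \<otimes>\<^bsub>G\<^esub> y) \<oplus>\<^bsub>R\<^esub> f x) \<oplus>\<^bsub>R\<^esub> l \<otimes>\<^bsub>R\<^esub> c (\<tau> x, \<tau> y)"
    if xy: "x \<in> carrier G" "y \<in> carrier G" for x y
  proof -
    have "D = \<ominus>\<^bsub>R\<^esub> v \<ominus>\<^bsub>R\<^esub> (\<ominus>\<^bsub>R\<^esub> w) \<oplus>\<^bsub>R\<^esub> \<ominus>\<^bsub>R\<^esub> u \<oplus>\<^bsub>R\<^esub> k"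
      if "w \<oplus>\<^bsub>R\<^esub> k = u \<oplus>\<^bsub>R\<^esub> v \<oplus>\<^bsub>R\<^esub> D" "w \<in> carrier R" "k \<in> carrier R" "u \<in> carrier R"
        "v \<in> carrier R" "D \<in> carrier R" for w k u v D
    proof -
      have "\<ominus>\<^bsub>R\<^esub> v \<ominus>\<^bsub>R\<^esub> (\<ominus>\<^bsub>R\<^esub> w) \<oplus>\<^bsub>R\<^esub> \<ominus>\<^bsub>R\<^esub> u \<oplus>\<^bsub>R\<^esub> k = \<ominus>\<^bsub>R\<^esub> v \<ominus>\<^bsub>R\<^esub> u \<oplus>\<^bsub>R\<^esub> (w \<oplus>\<^bsub>R\<^esub> k)"
        using that(2-) by algebra
      also have "\<dots> = D"
        unfolding that(1) using that(2-) by algebra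
      finally show ?thesis by simp
    qed
    from this[OF d_rel[of "\<tau> x" "\<tau> y"]] show ?thesis
      using xy by (simp add: f_def \<tau>_mem \<tau>_mult \<sigma>\<tau> mem cc dd l)
  qed
  then have "d = coboundary1 G R f \<otimes>\<^bsub>Z2 G R\<^esub> twist G R (s, l) c"
    using d by (intro extensionalityI[of _ "carrier G \<times> carrier G"])
      (auto simp: Z2_def coboundary1_def twist_def cocycles2_def PiE_def simp flip: \<tau>_def)
  then have "d \<in> cohomology_class G R (twist G R (s, l) c)"
    using f by (auto simp: cohomology_class_def r_coset_def coboundaries2_def)
  moreover have "(s, l) \<in> carrier (acting_group G R)"
    using s \<open>l \<in> Units R\<close> by (simp add: acting_group_def units_of_def)
  ultimately show ?thesis by blast
qed

section \<open>Orbits of classes and coefficients modulo \<open>p\<close>\<close>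

text \<open>Orbits are equivalence classes, and a coset equals that of \<open>d\<close> as soon as
  it contains \<open>d\<close>; so orbits of cosets become a relation between cocycles.\<close>

lemma same_orbit_class_iff:
  assumes "group G" and "cring R" and c: "c \<in> cocycles2 G R" and d: "d \<in> cocycles2 G R"
  shows "same_orbit G R (cohomology_class G R c) (cohomology_class G R d) \<longleftrightarrow>
    (\<exists>a\<in>carrier (acting_group G R). d \<in> cohomology_class G R (twist G R a c))"
proof -
  interpret Z: comm_group "Z2 G R" using assms(1,2) by (rule comm_group_Z2)
  interpret act: group_action "acting_group G R" "carrier (H2 G R)" "H2_action G R"
    using assms(1,2) by (rule group_action_H2)
  note B = normal_imp_subgroup[OF normal_coboundaries2[OF assms(1,2)]]
  let ?C = "cohomology_class G R c" and ?D = "cohomology_class G R d"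
  let ?orb = "orbit (acting_group G R) (H2_action G R)"
  have mem: "?C \<in> carrier (H2 G R)" "?D \<in> carrier (H2 G R)"
    using c d by (auto simp: H2_def FactGroup_def RCOSETS_def cohomology_class_def Z2_def)
  have class_eq: "cohomology_class G R b = ?D \<longleftrightarrow> d \<in> cohomology_class G R b"
    if "b \<in> cocycles2 G R" for b
    using that d Z.repr_independence[OF _ _ B] Z.repr_independenceD[OF B]
    by (auto simp: cohomology_class_def Z2_def)
  have "same_orbit G R ?C ?D \<longleftrightarrow> ?D \<in> ?orb ?C"
  proof
    assume "same_orbit G R ?C ?D"
    then obtain X where "X \<in> carrier (H2 G R)" "?C \<in> ?orb X" "?D \<in> ?orb X"
      by (auto simp: same_orbit_def orbits_def)
    then show "?D \<in> ?orb ?C"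
      using act.orbit_sym[of X ?C] act.orbit_trans[of ?C X ?D] mem by blast
  next
    assume "?D \<in> ?orb ?C"
    then show "same_orbit G R ?C ?D"
      using act.orbit_refl[OF mem(1)] mem(1) by (auto simp: same_orbit_def orbits_def)
  qed
  also have "\<dots> \<longleftrightarrow> (\<exists>a\<in>carrier (acting_group G R). cohomology_class G R (twist G R a c) = ?D)"
    unfolding orbit_def mem_Collect_eq using H2_action_class[OF assms(1,2) c] by metis
  also have "\<dots> \<longleftrightarrow> (\<exists>a\<in>carrier (acting_group G R). d \<in> cohomology_class G R (twist G R a c))"
    using class_eq twist_in_cocycles2[OF assms(1,2) c] by blast
  finally show ?thesis .
qed

text \<open>The additive group is generated by 1. The induction stays below the modulus, where
  \<open>int (Suc n)\<close> is its own residue.\<close>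

lemma (in residues) additive_endomorphism_eq_mult:
  assumes \<psi>: "\<psi> \<in> hom (add_monoid R) (add_monoid R)" and m: "k \<in> carrier R"
  shows "\<psi> k = \<psi> \<one> \<otimes> k"
proof -
  have \<psi>_add: "\<psi> ((x + y) mod m) = (\<psi> x + \<psi> y) mod m" if "x \<in> carrier R" "y \<in> carrier R" for x y
    using that \<psi> by (simp add: hom_def res_add_eq)
  have "int n < m \<Longrightarrow> \<psi> (int n) = (\<psi> 1 * int n) mod m" for n
  proof (induction n)
    case 0
    have "\<psi> \<zero> = \<zero>"
      using \<psi> hom_one[OF \<psi>] add.is_group by simp
    then show ?case by (simp add: res_zero_eq)
  next
    case (Suc n)
    then have "\<psi> (int (Suc n)) = (\<psi> (int n) + \<psi> 1) mod m"
      using \<psi>_add[of "int n" 1] m_gt_one by (simp add: res_carrier_eq add.commute)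
    then show ?case using Suc by (simp add: mod_simps algebra_simps)
  qed
  from this[of "nat k"] show ?thesis
    using m by (simp add: res_carrier_eq res_one_eq res_mult_eq)
qed

theorem proposition4p4:
  fixes G :: "('a, 'm) monoid_scheme" and p :: nat
  assumes "prime p"
    and "comm_group G" and "finite_p_group p G" and "carrier G \<noteq> {\<one>\<^bsub>G\<^esub>}"
    and "p = 2 \<Longrightarrow> \<not> has_cyclic_direct_factor G 2"
    and "c \<in> cocycles2 G (residue_ring (int p))" and "d \<in> cocycles2 G (residue_ring (int p))"
  shows "central_extension G (residue_ring (int p)) c \<cong> central_extension G (residue_ring (int p)) d
    \<longleftrightarrow> same_orbit G (residue_ring (int p))
          (cohomology_class G (residue_ring (int p)) c)
          (cohomology_class G (residue_ring (int p)) d)"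
proof -
  let ?R = "residue_ring (int p)"
  let ?C = "central_extension G ?R c" and ?D = "central_extension G ?R d"
  interpret G: comm_group G by fact
  have "1 < int p" using prime_gt_1_nat[OF \<open>prime p\<close>] by simp
  then interpret R: residues "int p" ?R by unfold_locales
  have ring: "group G" "cring ?R" by (rule G.is_group, rule R.cring)
  note cd = \<open>c \<in> cocycles2 G ?R\<close> \<open>d \<in> cocycles2 G ?R\<close>
  interpret C: group ?C by (rule group_central_extension[OF G.is_group R.ring_axioms cd(1)])
  interpret D: group ?D by (rule group_central_extension[OF G.is_group R.ring_axioms cd(2)])
  have card_R: "card (carrier ?R) = p" by (simp add: R.res_carrier_eq)
  have "\<exists>a\<in>carrier (acting_group G ?R). d \<in> cohomology_class G ?R (twist G ?R a c)"
    if iso: "?C \<cong> ?D"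
  proof -
    obtain \<phi> where \<phi>: "\<phi> \<in> iso ?C ?D" using iso by (auto simp: is_iso_def)
    let ?\<phi>' = "inv_into (carrier ?C) \<phi>"
    have \<phi>': "?\<phi>' \<in> iso ?D ?C" by (rule C.iso_set_sym[OF \<phi>])
    have bij: "bij_betw \<phi> (carrier ?C) (carrier ?D)" "bij_betw ?\<phi>' (carrier ?D) (carrier ?C)"
      using \<phi> \<phi>' by (simp_all add: iso_def)
    have surj: "fst ` carrier (central_extension G ?R b) = carrier G" for b
      using R.zero_closed by (force simp: central_extension_def)
    \<comment> \<open>A second projection of \<open>E_d\<close> onto \<open>G\<close>; its kernel is
      the image under \<phi> of the kernel of \<open>E_c\<close>.\<close>
    have g_hom: "fst \<circ> ?\<phi>' \<in> hom ?D G"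
      using \<phi>' by (intro hom_compose[OF _ hom_fst_central_extension[of G ?R c]]) (simp add: iso_def)
    have g_surj: "(fst \<circ> ?\<phi>') ` carrier ?D = carrier G"
      using bij(2) surj by (simp add: bij_betw_def flip: image_image image_comp)
    have M: "kernel ?C G fst = {\<one>\<^bsub>G\<^esub>} \<times> carrier ?R" "kernel ?D G fst = {\<one>\<^bsub>G\<^esub>} \<times> carrier ?R"
      by (rule kernel_fst_central_extension[OF G.monoid_axioms])+
    have g_kernel: "kernel ?D G (fst \<circ> ?\<phi>') = \<phi> ` kernel ?C G fst"
    proof -
      have inv: "?\<phi>' u \<in> carrier ?C" "\<phi> (?\<phi>' u) = u" if "u \<in> carrier ?D" for u
        using that bij by (auto simp: bij_betw_def f_inv_into_f inv_into_into)
      have inv': "?\<phi>' (\<phi> v) = v" "\<phi> v \<in> carrier ?D" if "v \<in> carrier ?C" for v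
        using that bij by (auto simp: bij_betw_def)
      show ?thesis
      proof
        show "kernel ?D G (fst \<circ> ?\<phi>') \<subseteq> \<phi> ` kernel ?C G fst"
        proof
          fix u assume "u \<in> kernel ?D G (fst \<circ> ?\<phi>')"
          then have "?\<phi>' u \<in> kernel ?C G fst" "\<phi> (?\<phi>' u) = u"
            using inv by (simp_all add: kernel_def)
          then show "u \<in> \<phi> ` kernel ?C G fst" by (metis imageI)
        qed
      qed (use inv' in \<open>auto simp: kernel_def\<close>)
    qed
    have M_card: "card (kernel ?C G fst) = p" "card (kernel ?D G fst) = p"
      unfolding M by (simp_all add: card_cartesian_product card_R)
    have "card (\<phi> ` kernel ?C G fst) = card (kernel ?C G fst)"
      using bij(1) by (intro card_image) (auto simp: bij_betw_def kernel_def intro: inj_on_subset)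
    then have g_card: "card (kernel ?D G (fst \<circ> ?\<phi>')) = p" unfolding g_kernel M_card .
    obtain n where G_fin: "finite (carrier G)" "order G = p ^ n"
      using \<open>finite_p_group p G\<close> by (auto simp: finite_p_group_def)
    have D_fin: "finite (carrier ?D)" "order ?D = p ^ Suc n"
      using G_fin card_R by (simp_all add: central_extension_def order_def card_cartesian_product)
    obtain \<alpha> where \<alpha>: "\<alpha> \<in> iso ?D ?D" "\<alpha> ` kernel ?D G (fst \<circ> ?\<phi>') = kernel ?D G fst"
      using exists_automorphism_between_kernels[OF \<open>prime p\<close> D.is_group D_fin G.comm_group_axioms
          hom_fst_central_extension surj M_card(2) g_hom g_surj g_card] by blast
    \<comment> \<open>The corrected isomorphism carries kernel to kernel.\<close>
    have "(\<alpha> \<circ> \<phi>) ` ({\<one>\<^bsub>G\<^esub>} \<times> carrier ?R) = {\<one>\<^bsub>G\<^esub>} \<times> carrier ?R"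
      using \<alpha>(2) unfolding g_kernel M by (simp add: image_comp)
    then show ?thesis
      using twist_of_central_extension_iso[OF ring cd R.additive_endomorphism_eq_mult
          iso_set_trans[OF \<phi> \<alpha>(1)]] by blast
  qed
  then show ?thesis
    using central_extension_iso_of_twist[OF ring cd(1)] same_orbit_class_iff[OF ring cd] by blast
qed

end
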